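(* Let $A\in\mathrm{End}(\mathbb C^n\otimes\mathbb C^n)$ be an idempotent such that $P_A=1-2A$ satisfies the braid relation, and let $M$ be an $n\times n$ $A$-Manin matrix over $\mathfrak R$. Define in $\mathfrak R[[t]]$ $$S(t)=\sum_{k\ge0}t^k\,\mathrm{tr}_{1,\dots,k}S^{(k)}M_1\cdots M_k,\quad A(t)=\sum_{k\ge0}(-t)^k\,\mathrm{tr}_{1,\dots,k}A^{(k)}M_1\cdots M_k,\quad T(t)=\sum_{k\ge0}t^k\,\mathrm{tr}\,M^{[k+1]},$$ (the $k=0$ terms of $S(t),A(t)$ being $1$). Then $\partial_tA(t)=-A(t)T(t)$ and $\partial_tS(t)=T(t)S(t)$.
   Context: $\mathfrak R$ is an associative unital algebra over $\mathbb C$. $P_A$ satisfies $P_A^{(12)}P_A^{(23)}P_A^{(12)}=P_A^{(23)}P_A^{(12)}P_A^{(23)}$; with $P_A^2=1$, $s_i\mapsto P_A^{(i,i+1)}$ defines an action $\sigma\mapsto P_A^{\sigma}$ of $S_k$ on $(\mathbb C^n)^{\otimes k}$; $S^{(k)}=\frac1{k!}\sum_{\sigma}P_A^{\sigma}$, $A^{(k)}=\frac1{k!}\sum_\sigma\mathrm{sgn}(\sigma)P_A^{\sigma}$. $M_a$ is $M$ acting on the $a$-th tensor factor; $M$ is $A$-Manin if $AM_1M_2(1-A)=0$. $\mathrm{tr}_{1,\dots,k}$ is the full trace over $(\mathbb C^n)^{\otimes k}$ and $\mathrm{tr}$ the trace of an $n\times n$ matrix, with values in $\mathfrak R$. For $n\times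 n$ matrices $B,C$ over $\mathfrak R$, $B*C=\mathrm{tr}_1(P_AB_1C_2)$ (partial trace over the first factor). $M^{[0]}=1$, $M^{[1]}=M$, $M^{[k]}=M^{[k-1]}*M$ for $k>1$. $\partial_t$ is the formal derivative. *)

theory Defs
  imports "HOL-Combinatorics.Combinatorics" "HOL-Computational_Algebra.Formal_Power_Series"
begin

(* Operators on (C^n)^{\<otimes>k} are represented by their matrices w.r.t. the
   standard basis, indexed by multi-indices u = [u_0,...,u_{k-1}] (lists of
   length k with entries < n).  Tensor factor a (paper: a+1) is list position a. *)

definition idx :: "nat \<Rightarrow> nat \<Rightarrow> nat list set" where
  "idx n k = {u. length u = k \<and> (\<forall>x\<in>set u. x < n)}"

type_synonym 'a op = "nat list \<Rightarrow> nat list \<Rightarrow> 'a"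

definition mmul :: "nat \<Rightarrow> nat \<Rightarrow> 'a::semiring_0 op \<Rightarrow> 'a op \<Rightarrow> 'a op" where
  "mmul n k X Y = (\<lambda>u w. \<Sum>v\<in>idx n k. X u v * Y v w)"

definition opid :: "'a::{zero,one} op" where
  "opid = (\<lambda>u w. if u = w then 1 else 0)"

(* an operator on C^n \<otimes> C^n given by F i j i' j' = <e_i \<otimes> e_j | F | e_i' \<otimes> e_j'> *)
definition op2 :: "(nat \<Rightarrow> nat \<Rightarrow> nat \<Rightarrow> nat \<Rightarrow> 'a) \<Rightarrow> 'a op" where
  "op2 F = (\<lambda>u w. F (u!0) (u!1) (w!0) (w!1))"

definition Padj :: "(nat \<Rightarrow> nat \<Rightarrow> nat \<Rightarrow> nat \<Rightarrow> 'a::zero) \<Rightarrow> nat \<Rightarrow> 'a op" where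
  "Padj F a = (\<lambda>u w. if length u = length w \<and> Suc a < length u \<and>
       (\<forall>i<length u. i \<noteq> a \<and> i \<noteq> Suc a \<longrightarrow> u!i = w!i)
     then F (u!a) (u!Suc a) (w!a) (w!Suc a) else 0)"

definition PA :: "(nat \<Rightarrow> nat \<Rightarrow> nat \<Rightarrow> nat \<Rightarrow> complex) \<Rightarrow> nat \<Rightarrow> nat \<Rightarrow> nat \<Rightarrow> nat \<Rightarrow> complex" where
  "PA A = (\<lambda>i j i' j'. (if i = i' \<and> j = j' then 1 else 0) - 2 * A i j i' j')"

definition wordperm :: "nat list \<Rightarrow> nat \<Rightarrow> nat" where
  "wordperm ws = foldr (\<lambda>i f. transpose i (Suc i) \<circ> f) ws id"

definition Pword :: "nat \<Rightarrow> nat \<Rightarrow> (nat \<Rightarrow> nat \<Rightarrow> nat \<Rightarrow> nat \<Rightarrow> complex) \<Rightarrow> nat list \<Rightarrow> complex op" where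
  "Pword n k P ws = foldr (\<lambda>i X. mmul n k (Padj P i) X) ws opid"

(* P^\<sigma>: image of \<sigma> under the homomorphism s_i \<mapsto> P^{(i,i+1)} *)
definition Pperm :: "nat \<Rightarrow> nat \<Rightarrow> (nat \<Rightarrow> nat \<Rightarrow> nat \<Rightarrow> nat \<Rightarrow> complex) \<Rightarrow> (nat \<Rightarrow> nat) \<Rightarrow> complex op" where
  "Pperm n k P \<sigma> = Pword n k P (SOME ws. (\<forall>i\<in>set ws. Suc i < k) \<and> wordperm ws = \<sigma>)"

definition Ssym :: "nat \<Rightarrow> nat \<Rightarrow> (nat \<Rightarrow> nat \<Rightarrow> nat \<Rightarrow> nat \<Rightarrow> complex) \<Rightarrow> complex op" where
  "Ssym n k P = (\<lambda>u w. (1 / fact k) * (\<Sum>\<sigma> | \<sigma> permutes {..<k}. Pperm n k P \<sigma> u w))"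

definition Asym :: "nat \<Rightarrow> nat \<Rightarrow> (nat \<Rightarrow> nat \<Rightarrow> nat \<Rightarrow> nat \<Rightarrow> complex) \<Rightarrow> complex op" where
  "Asym n k P = (\<lambda>u w. (1 / fact k) *
      (\<Sum>\<sigma> | \<sigma> permutes {..<k}. of_int (sign \<sigma>) * Pperm n k P \<sigma> u w))"

definition Mprod :: "(nat \<Rightarrow> nat \<Rightarrow> 'r::monoid_mult) \<Rightarrow> 'r op" where
  "Mprod M = (\<lambda>u w. prod_list (map (\<lambda>(i, j). M i j) (zip u w)))"

(* scalar operator embedded into R via the structure map c : C \<rightarrow> R *)
definition cop :: "(complex \<Rightarrow> 'r) \<Rightarrow> complex op \<Rightarrow> 'r op" where
  "cop c X = (\<lambda>u w. c (X u w))"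

definition trk :: "nat \<Rightarrow> nat \<Rightarrow> 'a::comm_monoid_add op \<Rightarrow> 'a" where
  "trk n k X = (\<Sum>u\<in>idx n k. X u u)"

definition is_Manin :: "(complex \<Rightarrow> 'r::ring_1) \<Rightarrow> nat \<Rightarrow> (nat \<Rightarrow> nat \<Rightarrow> nat \<Rightarrow> nat \<Rightarrow> complex)
    \<Rightarrow> (nat \<Rightarrow> nat \<Rightarrow> 'r) \<Rightarrow> bool" where
  "is_Manin c n A M \<longleftrightarrow> (\<forall>u\<in>idx n 2. \<forall>w\<in>idx n 2.
     mmul n 2 (mmul n 2 (cop c (op2 A)) (Mprod M))
       (cop c (\<lambda>u w. opid u w - op2 A u w)) u w = 0)"

(* B * C = tr_1(P_A B_1 C_2) *)
definition starP :: "(complex \<Rightarrow> 'r::ring_1) \<Rightarrow> nat \<Rightarrow> (nat \<Rightarrow> nat \<Rightarrow> nat \<Rightarrow> nat \<Rightarrow> complex)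
    \<Rightarrow> (nat \<Rightarrow> nat \<Rightarrow> 'r) \<Rightarrow> (nat \<Rightarrow> nat \<Rightarrow> 'r) \<Rightarrow> nat \<Rightarrow> nat \<Rightarrow> 'r" where
  "starP c n P B C = (\<lambda>i j. \<Sum>a<n. \<Sum>p<n. \<Sum>q<n. c (P a i p q) * B p a * C q j)"

fun Mbr :: "(complex \<Rightarrow> 'r::ring_1) \<Rightarrow> nat \<Rightarrow> (nat \<Rightarrow> nat \<Rightarrow> nat \<Rightarrow> nat \<Rightarrow> complex)
    \<Rightarrow> (nat \<Rightarrow> nat \<Rightarrow> 'r) \<Rightarrow> nat \<Rightarrow> nat \<Rightarrow> nat \<Rightarrow> 'r" where
  "Mbr c n P M 0 = (\<lambda>i j. if i = j then 1 else 0)"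
| "Mbr c n P M (Suc 0) = M"
| "Mbr c n P M (Suc (Suc k)) = starP c n P (Mbr c n P M (Suc k)) M"

definition Sser :: "(complex \<Rightarrow> 'r::ring_1) \<Rightarrow> nat \<Rightarrow> (nat \<Rightarrow> nat \<Rightarrow> nat \<Rightarrow> nat \<Rightarrow> complex)
    \<Rightarrow> (nat \<Rightarrow> nat \<Rightarrow> 'r) \<Rightarrow> 'r fps" where
  "Sser c n A M = Abs_fps (\<lambda>k. trk n k (mmul n k (cop c (Ssym n k (PA A))) (Mprod M)))"

definition Aser :: "(complex \<Rightarrow> 'r::ring_1) \<Rightarrow> nat \<Rightarrow> (nat \<Rightarrow> nat \<Rightarrow> nat \<Rightarrow> nat \<Rightarrow> complex)
    \<Rightarrow> (nat \<Rightarrow> nat \<Rightarrow> 'r) \<Rightarrow> 'r fps" where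
  "Aser c n A M = Abs_fps (\<lambda>k. (- 1) ^ k * trk n k (mmul n k (cop c (Asym n k (PA A))) (Mprod M)))"

definition Tser :: "(complex \<Rightarrow> 'r::ring_1) \<Rightarrow> nat \<Rightarrow> (nat \<Rightarrow> nat \<Rightarrow> nat \<Rightarrow> nat \<Rightarrow> complex)
    \<Rightarrow> (nat \<Rightarrow> nat \<Rightarrow> 'r) \<Rightarrow> 'r fps" where
  "Tser c n A M = Abs_fps (\<lambda>k. \<Sum>i<n. Mbr c n (PA A) M (Suc k) i i)"

end

theory Submission
  imports Defs
begin

text \<open>
  Since \<open>P\<^sub>A\<close> and \<open>-P\<^sub>A\<close> satisfy the Coxeter relations, both symmetrizers are treated as the
  symmetrizer \<open>e\<^sub>m\<close> of generators \<open>Q\<^sub>i = \<plusminus>P\<^sub>A\<close> acting on neighbouring factors, for which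
  \<open>(m + 1) e\<^sub>m\<^sub>+\<^sub>1 = e\<^sub>m + m e\<^sub>m Q\<^sub>m\<^sub>-\<^sub>1 e\<^sub>m\<close>.  The Manin relation gives \<open>e M e = e M\<close> for the antisymmetrizer
  (and \<open>e M e = M e\<close> for the symmetrizer), where \<open>M\<close> stands for \<open>M\<^sub>1 \<dots> M\<^sub>k\<close>.  As \<open>e\<^sub>m\<close> has central entries
  it can be moved cyclically under the trace and absorbed, so that
  \<open>k tr(e\<^sub>k M) = \<Sum>\<^sub>m tr(Q\<^sub>k\<^sub>-\<^sub>2 \<dots> Q\<^sub>m e\<^sub>m M)\<close>.  In each summand \<open>e\<^sub>m\<close> acts on the first \<open>m\<close> factors and the
  other operators on the remaining ones; hence it splits into \<open>tr(e\<^sub>m M\<^sub>1 \<dots> M\<^sub>m)\<close> times, up to sign, the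
  trace of \<open>P\<^sub>A M\<^sub>1 \<dots>\<close> along a full cycle, which is \<open>tr M\<^sup>[\<^sup>k\<^sup>-\<^sup>m\<^sup>]\<close>.  These are the coefficient identities
  of the derivative formulas.  For the symmetrizer the same argument runs with the generators in
  reversed order.
\<close>

unbundle fps_syntax

section \<open>Words in adjacent transpositions\<close>

text \<open>The inverse of the cycle \<open>wordperm [j..<m]\<close>, given pointwise so that its
  products with transpositions reduce to case distinctions. For \<open>j = \<sigma> m\<close>,
  composing it with \<open>\<sigma>\<close> gives a permutation fixing \<open>m\<close>.\<close>

definition cyc_down :: "nat \<Rightarrow> nat \<Rightarrow> nat \<Rightarrow> nat" where
  "cyc_down j m x = (if x = j then m else if j < x \<and> x \<le> m then x - 1 else x)"

text \<open>A permutation \<open>\<sigma>\<close> of \<open>{..m}\<close> factors as \<open>s\<^sub>j s\<^sub>j\<^sub>+\<^sub>1 \<dots> s\<^sub>m\<^sub>-\<^sub>1 \<tau>\<close> with \<open>j = \<sigma> m\<close> and \<open>\<tau>\<close> fixing \<open>m\<close>;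
  iterating this yields the normal form.\<close>

fun nf_word :: "nat \<Rightarrow> (nat \<Rightarrow> nat) \<Rightarrow> nat list" where
  "nf_word 0 \<sigma> = []"
| "nf_word (Suc m) \<sigma> = [\<sigma> m..<m] @ nf_word m (cyc_down (\<sigma> m) m \<circ> \<sigma>)"

lemma wordperm_Nil [simp]: "wordperm [] = id"
  by (simp add: wordperm_def)

lemma wordperm_Cons [simp]: "wordperm (i # ws) = transpose i (Suc i) \<circ> wordperm ws"
  by (simp add: wordperm_def)

lemma wordperm_append: "wordperm (us @ ws) = wordperm us \<circ> wordperm ws"
  by (induction us) (auto simp: o_assoc)

lemma permutes_wordperm: "\<forall>i\<in>set ws. Suc i < k \<Longrightarrow> wordperm ws permutes {..<k}"
proof (induction ws)
  case (Cons i ws)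
  have "transpose i (Suc i) permutes {..<k}"
    using Cons.prems by (intro permutes_swap_id) auto
  then show ?case using Cons by (simp add: permutes_compose del: o_apply)
qed (simp add: permutes_id)

lemma sign_wordperm: "sign (wordperm ws) = (- 1) ^ length ws"
proof (induction ws)
  case (Cons i ws)
  \<comment> \<open>Multiplicativity of \<open>sign\<close> needs finite support, which the largest
    letter bounds; for the empty word the condition on letters is vacuous.\<close>
  have "wordperm ws permutes {..<Suc (Suc (Max (set ws)))}"
    by (rule permutes_wordperm) (auto simp: less_Suc_eq_le)
  then have "permutation (wordperm ws)"
    by (auto simp: permutation_permutes)
  then show ?case using Cons by (simp add: sign_compose permutation_swap_id sign_swap_id del: o_apply)
qed simp

lemma cyc_down_self [simp]: "cyc_down m m = id"
  by (auto simp: cyc_down_def fun_eq_iff)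

lemma cyc_down_transpose_le: "j < m \<Longrightarrow> cyc_down (Suc j) m \<circ> transpose j (Suc j) = cyc_down j m"
  by (auto simp: cyc_down_def fun_eq_iff transpose_def)

lemma cyc_down_transpose_less:
  "Suc i < j \<Longrightarrow> j \<le> m \<Longrightarrow> cyc_down j m \<circ> transpose i (Suc i) = transpose i (Suc i) \<circ> cyc_down j m"
  by (auto simp: cyc_down_def fun_eq_iff transpose_def)

lemma cyc_down_transpose_gt:
  "j \<le> i \<Longrightarrow> Suc i < m \<Longrightarrow>
    cyc_down j m \<circ> transpose (Suc i) (Suc (Suc i)) = transpose i (Suc i) \<circ> cyc_down j m"
  by (auto simp: cyc_down_def fun_eq_iff transpose_def)

text \<open>Peeling off the first letter s_j exposes a second s_j, the one relating
  \<open>cyc_down j m\<close> to \<open>cyc_down (Suc j) m\<close>; the two enclose the inductive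
  identity and cancel.\<close>

lemma wordperm_upt_cyc_down:
  assumes "j \<le> m" shows "wordperm [j..<m] \<circ> cyc_down j m = id"
  using assms
proof (induction rule: inc_induct)
  case (step j)
  have "wordperm [j..<m] \<circ> cyc_down j m
      = transpose j (Suc j) \<circ> (wordperm [Suc j..<m] \<circ> cyc_down (Suc j) m) \<circ> transpose j (Suc j)"
    using step.hyps by (simp add: upt_conv_Cons o_assoc[symmetric] cyc_down_transpose_le)
  then show ?case by (simp add: step.IH)
qed simp

lemma cyc_down_wordperm_upt:
  assumes "j \<le> m" shows "cyc_down j m \<circ> wordperm [j..<m] = id"
  using assms
proof (induction rule: inc_induct)
  case (step j)
  have "cyc_down j m \<circ> wordperm [j..<m]
      = cyc_down (Suc j) m \<circ> (transpose j (Suc j) \<circ> transpose j (Suc j)) \<circ> wordperm [Suc j..<m]"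
    using step.hyps by (simp add: upt_conv_Cons cyc_down_transpose_le[symmetric] o_assoc del: o_apply transpose_comp_involutory)
  then show ?case by (simp add: step.IH)
qed simp

lemma permutes_cyc_down:
  assumes "j \<le> m" shows "cyc_down j m permutes {..<Suc m}"
proof -
  have w: "wordperm [j..<m] permutes {..<Suc m}" by (rule permutes_wordperm) auto
  have "cyc_down j m = cyc_down j m \<circ> (wordperm [j..<m] \<circ> inv (wordperm [j..<m]))"
    using permutes_inv_o(1)[OF w] by simp
  also have "\<dots> = inv (wordperm [j..<m])"
    using cyc_down_wordperm_upt[OF assms] by (simp add: o_assoc)
  finally show ?thesis using permutes_inv[OF w] by simp
qed

lemma permutes_lessThan_Suc:
  assumes "\<tau> permutes {..<Suc m}" "\<tau> m = m" shows "\<tau> permutes {..<m}"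
  by (rule permutes_superset[OF assms(1)]) (use assms(2) in \<open>auto simp: less_Suc_eq\<close>)

lemma cyc_down_comp_permutes:
  assumes "\<sigma> permutes {..<Suc m}" shows "\<sigma> m \<le> m" "cyc_down (\<sigma> m) m \<circ> \<sigma> permutes {..<m}"
proof -
  show le: "\<sigma> m \<le> m" using permutes_in_image[OF assms, of m] by auto
  show "cyc_down (\<sigma> m) m \<circ> \<sigma> permutes {..<m}"
    using permutes_compose[OF assms permutes_cyc_down[OF le]]
    by (rule permutes_lessThan_Suc) (simp add: cyc_down_def)
qed

lemma set_nf_word: "\<sigma> permutes {..<k} \<Longrightarrow> i \<in> set (nf_word k \<sigma>) \<Longrightarrow> Suc i < k"
proof (induction k arbitrary: \<sigma>)
  case (Suc k)
  show ?case using Suc.prems(2) Suc.IH[OF cyc_down_comp_permutes(2)[OF Suc.prems(1)]] by fastforce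
qed simp

lemma wordperm_nf_word: "\<sigma> permutes {..<k} \<Longrightarrow> wordperm (nf_word k \<sigma>) = \<sigma>"
proof (induction k arbitrary: \<sigma>)
  case (Suc k)
  have "wordperm (nf_word (Suc k) \<sigma>) = (wordperm [\<sigma> k..<k] \<circ> cyc_down (\<sigma> k) k) \<circ> \<sigma>"
    using Suc.IH[OF cyc_down_comp_permutes(2)[OF Suc.prems]] by (simp add: wordperm_append o_assoc del: o_apply)
  then show ?case
    using wordperm_upt_cyc_down[OF cyc_down_comp_permutes(1)[OF Suc.prems]] by simp
qed simp

text \<open>The element \<open>\<kappa> m\<close> is the inverse of \<open>m!\<close>.\<close>

locale coxeter_gens =
  fixes Q :: "nat \<Rightarrow> 'a::ring_1" and N :: nat and \<kappa> :: "nat \<Rightarrow> 'a"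
  assumes sq: "i < N \<Longrightarrow> Q i * Q i = 1"
    and braid: "Suc i < N \<Longrightarrow> Q i * Q (Suc i) * Q i = Q (Suc i) * Q i * Q (Suc i)"
    and comm: "Suc i < j \<Longrightarrow> j < N \<Longrightarrow> Q i * Q j = Q j * Q i"
    and central: "\<kappa> m * x = x * \<kappa> m"
    and inverse_fact: "\<kappa> m * of_nat (fact m) = 1"
begin

section \<open>Words in Coxeter generators depend only on the permutation\<close>

definition wprod :: "nat list \<Rightarrow> 'a" where
  "wprod ws = prod_list (map Q ws)"

lemma wprod_simps [simp]: "wprod [] = 1" "wprod (i # ws) = Q i * wprod ws"
    "wprod (us @ ws) = wprod us * wprod ws"
  by (simp_all add: wprod_def)

lemma commute_wprod:
  "\<forall>j\<in>set ws. x * Q j = Q j * x \<Longrightarrow> x * wprod ws = wprod ws * x"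
proof (induction ws)
  case (Cons j ws)
  have "x * wprod (j # ws) = Q j * (x * wprod ws)"
    using Cons.prems by (simp add: mult.assoc[symmetric])
  then show ?case using Cons by (simp add: mult.assoc)
qed simp

lemma gen_mult_wprod_less:
  assumes "Suc i < j" "m \<le> N" shows "Q i * wprod [j..<m] = wprod [j..<m] * Q i"
  by (rule commute_wprod) (use assms comm in auto)

text \<open>Q_{i+1} commutes with the letters below i, the braid relation carries it across the
  letters i, i+1 and lowers its index, and the resulting Q_i commutes with the remaining
  letters.\<close>

lemma gen_mult_wprod_gt:
  assumes "j \<le> i" "Suc i < m" "m \<le> N"
  shows "Q (Suc i) * wprod [j..<m] = wprod [j..<m] * Q i"
proof -
  have s: "[j..<m] = [j..<i] @ i # Suc i # [Suc (Suc i)..<m]"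
    using assms upt_add_eq_append[of j i "m - i"] by (simp add: upt_conv_Cons)
  have l: "Q (Suc i) * wprod [j..<i] = wprod [j..<i] * Q (Suc i)"
    by (rule commute_wprod) (use assms in \<open>auto simp: comm[symmetric]\<close>)
  have r: "Q i * wprod [Suc (Suc i)..<m] = wprod [Suc (Suc i)..<m] * Q i"
    by (rule gen_mult_wprod_less) (use assms in auto)
  have "Q (Suc i) * wprod [j..<m]
      = wprod [j..<i] * (Q (Suc i) * Q i * Q (Suc i)) * wprod [Suc (Suc i)..<m]"
    unfolding s by (simp add: mult.assoc[symmetric] l)
  also have "\<dots> = wprod [j..<i] * Q i * Q (Suc i) * (Q i * wprod [Suc (Suc i)..<m])"
    using braid[of i, symmetric] assms by (simp only: mult.assoc)
  finally show ?thesis unfolding s r by (simp add: mult.assoc)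
qed

text \<open>Left multiplication by s_i changes a normal form in one of four ways, according to the
  leading coset word j, ..., m-1. If i = j, the first letter cancels; if j = i+1, the letter i is
  prepended; if i+1 < j, Q_i passes the coset word unchanged; if j < i, it passes with index i-1. In
  the last two cases induction applies to the tail. The N generators realise the symmetric group on
  N+1 points, whence the bound \<open>Suc N\<close>.\<close>

lemma gen_mult_nf_word:
  assumes "Suc i < k" "k \<le> Suc N" "\<sigma> permutes {..<k}"
  shows "Q i * wprod (nf_word k \<sigma>) = wprod (nf_word k (transpose i (Suc i) \<circ> \<sigma>))"
  using assms
proof (induction k arbitrary: i \<sigma>)
  case (Suc m)
  define j where "j = \<sigma> m"
  have j: "j \<le> m" and p: "cyc_down j m \<circ> \<sigma> permutes {..<m}"
    using cyc_down_comp_permutes[OF Suc.prems(3)] by (auto simp: j_def)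
  have m: "m \<le> N" "i < m" using Suc.prems by auto
  consider (eq) "i = j" | (pred) "j = Suc i" | (less) "Suc i < j" | (gt) i' where "i = Suc i'" "j \<le> i'"
    by (metis Suc_lessI less_imp_Suc_add linorder_neqE_nat le_add1)
  then show ?case
  proof cases
    case eq
    have "cyc_down (Suc j) m \<circ> (transpose j (Suc j) \<circ> \<sigma>) = cyc_down j m \<circ> \<sigma>"
      using m eq by (simp add: o_assoc cyc_down_transpose_le)
    moreover have "(transpose i (Suc i) \<circ> \<sigma>) m = Suc j" by (simp add: eq j_def)
    ultimately show ?thesis using eq m sq[of j]
      by (simp add: j_def[symmetric] upt_conv_Cons mult.assoc[symmetric] del: o_apply)
  next
    case pred
    have "cyc_down i m \<circ> (transpose i (Suc i) \<circ> \<sigma>) = cyc_down j m \<circ> \<sigma>"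
      using m pred by (simp add: cyc_down_transpose_le[symmetric] fun_eq_iff)
    moreover have "(transpose i (Suc i) \<circ> \<sigma>) m = i" using pred by (simp add: j_def)
    ultimately show ?thesis using pred m
      by (simp add: j_def[symmetric] upt_conv_Cons mult.assoc del: o_apply)
  next
    case less
    have t: "(transpose i (Suc i) \<circ> \<sigma>) m = j" using less by (simp add: transpose_def j_def)
    have "cyc_down j m \<circ> (transpose i (Suc i) \<circ> \<sigma>) = transpose i (Suc i) \<circ> (cyc_down j m \<circ> \<sigma>)"
      using less j by (simp add: o_assoc cyc_down_transpose_less)
    moreover have "Q i * wprod (nf_word m (cyc_down j m \<circ> \<sigma>))
       = wprod (nf_word m (transpose i (Suc i) \<circ> (cyc_down j m \<circ> \<sigma>)))"
      using Suc.IH[OF _ _ p, of i] less j m by (simp del: o_apply)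
    ultimately show ?thesis
      using mult.assoc[of "Q i"] mult.assoc[of "wprod [j..<m]"] gen_mult_wprod_less[OF less m(1)]
      by (simp add: j_def[symmetric] t del: o_apply) metis
  next
    case gt
    have t: "(transpose i (Suc i) \<circ> \<sigma>) m = j" using gt by (simp add: transpose_def j_def)
    have "cyc_down j m \<circ> (transpose i (Suc i) \<circ> \<sigma>) = transpose i' (Suc i') \<circ> (cyc_down j m \<circ> \<sigma>)"
      using gt j m by (simp add: o_assoc cyc_down_transpose_gt)
    moreover have "Q i' * wprod (nf_word m (cyc_down j m \<circ> \<sigma>))
       = wprod (nf_word m (transpose i' (Suc i') \<circ> (cyc_down j m \<circ> \<sigma>)))"
      using Suc.IH[OF _ _ p, of i'] gt j m by (simp del: o_apply)
    moreover have "Q i * wprod [j..<m] = wprod [j..<m] * Q i'"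
      using gen_mult_wprod_gt[OF gt(2) _ m(1)] gt m by simp
    ultimately show ?thesis
      using mult.assoc[of "Q i"] mult.assoc[of "wprod [j..<m]"]
      by (simp add: j_def[symmetric] t del: o_apply) metis
  qed
qed simp

lemma wprod_nf_word_id: "wprod (nf_word k id) = 1"
  by (induction k) simp_all

text \<open>The braid, commutation and involution relations suffice to bring every word into normal
  form, so a product of generators depends only on the permutation.\<close>

theorem wprod_word:
  assumes "k \<le> Suc N" "\<forall>i\<in>set ws. Suc i < k"
  shows "wprod ws = wprod (nf_word k (wordperm ws))"
  using assms(2)
proof (induction ws)
  case (Cons i ws)
  then show ?case
    using gen_mult_nf_word[of i k "wordperm ws"] permutes_wordperm[of ws k] assms(1) by (simp del: o_apply)
qed (simp add: wprod_nf_word_id)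

section \<open>The symmetrizer of the generators and its recursion\<close>

definition symsum :: "nat \<Rightarrow> 'a" where
  "symsum k = (\<Sum>\<sigma> | \<sigma> permutes {..<k}. wprod (nf_word k \<sigma>))"

definition symm :: "nat \<Rightarrow> 'a" where
  "symm k = \<kappa> k * symsum k"

lemma gen_mult_symsum:
  assumes "Suc i < k" "k \<le> Suc N" shows "Q i * symsum k = symsum k"
proof -
  let ?s = "transpose i (Suc i)"
  have s: "?s permutes {..<k}" using assms by (intro permutes_swap_id) auto
  have "Q i * symsum k = (\<Sum>\<sigma> | \<sigma> permutes {..<k}. wprod (nf_word k (?s \<circ> \<sigma>)))"
    using assms by (simp add: symsum_def sum_distrib_left gen_mult_nf_word)
  also have "\<dots> = symsum k"
    unfolding symsum_def
    by (rule sum.reindex_bij_witness[of _ "\<lambda>\<sigma>. ?s \<circ> \<sigma>" "\<lambda>\<sigma>. ?s \<circ> \<sigma>"])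
      (use s in \<open>auto simp: o_assoc intro: permutes_compose\<close>)
  finally show ?thesis .
qed

lemma symsum_mult_gen:
  assumes "Suc i < k" "k \<le> Suc N" shows "symsum k * Q i = symsum k"
proof -
  let ?s = "transpose i (Suc i)"
  have s: "?s permutes {..<k}" using assms by (intro permutes_swap_id) auto
  \<comment> \<open>The normal form is built for multiplication on the left; on the right, the
    letter is appended and the whole word is normalised again.\<close>
  have "wprod (nf_word k \<sigma>) * Q i = wprod (nf_word k (\<sigma> \<circ> ?s))" if "\<sigma> permutes {..<k}" for \<sigma>
    using wprod_word[of k "nf_word k \<sigma> @ [i]"] assms that
    by (auto simp: wordperm_append wordperm_nf_word set_nf_word)
  then have "symsum k * Q i = (\<Sum>\<sigma> | \<sigma> permutes {..<k}. wprod (nf_word k (\<sigma> \<circ> ?s)))"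
    by (simp add: symsum_def sum_distrib_right)
  also have "\<dots> = symsum k"
    unfolding symsum_def
    by (rule sum.reindex_bij_witness[of _ "\<lambda>\<sigma>. \<sigma> \<circ> ?s" "\<lambda>\<sigma>. \<sigma> \<circ> ?s"])
      (use s in \<open>auto simp: comp_assoc intro: permutes_compose\<close>)
  finally show ?thesis .
qed

lemma gen_mult_symm: "Suc i < k \<Longrightarrow> k \<le> Suc N \<Longrightarrow> Q i * symm k = symm k"
  unfolding symm_def by (metis central gen_mult_symsum mult.assoc)

lemma symm_mult_gen: "Suc i < k \<Longrightarrow> k \<le> Suc N \<Longrightarrow> symm k * Q i = symm k"
  by (simp add: symm_def symsum_mult_gen mult.assoc)

text \<open>Every word fixes \<open>x\<close>, so the sum over permutations is k! times
  \<open>x\<close>, and \<open>\<kappa> k\<close> removes the factorial. Later identities between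
  symmetrizers rest on this criterion and its mirror image.\<close>

lemma symm_absorb_left:
  assumes "\<And>i. Suc i < k \<Longrightarrow> Q i * x = x"
  shows "symm k * x = x"
proof -
  have "wprod ws * x = x" if "\<forall>i\<in>set ws. Suc i < k" for ws
    using that by (induction ws) (auto simp: mult.assoc assms)
  then have "symsum k * x = (\<Sum>\<sigma> | \<sigma> permutes {..<k}. x)"
    by (simp add: symsum_def sum_distrib_right set_nf_word)
  then show ?thesis
    using inverse_fact[of k] by (simp add: symm_def card_permutations mult.assoc)
      (simp add: mult.assoc[symmetric])
qed

lemma symm_absorb_right:
  assumes "\<And>i. Suc i < k \<Longrightarrow> x * Q i = x"
  shows "x * symm k = x"
proof -
  have "x * wprod ws = x" if "\<forall>i\<in>set ws. Suc i < k" for ws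
    using that by (induction ws) (auto simp: mult.assoc[symmetric] assms)
  then have "x * symsum k = (\<Sum>\<sigma> | \<sigma> permutes {..<k}. x)"
    by (simp add: symsum_def sum_distrib_left set_nf_word)
  also have "\<dots> = of_nat (fact k) * x" by (simp add: card_permutations)
  finally show ?thesis
    using inverse_fact[of k] by (metis central mult.assoc mult_1 symm_def)
qed

lemma symm_idem: "k \<le> Suc N \<Longrightarrow> symm k * symm k = symm k"
  by (rule symm_absorb_left) (simp add: gen_mult_symm)

text \<open>Decomposition into cosets of the stabiliser of \<open>m\<close>: the coset of a
  permutation is determined by the image j of \<open>m\<close>, and normal forms are built along
  this factorisation.\<close>

lemma symsum_Suc: "symsum (Suc m) = (\<Sum>j\<le>m. wprod [j..<m] * symsum m)"
proof -
  have "(\<Sum>j\<le>m. wprod [j..<m] * symsum m)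
      = (\<Sum>(j, \<tau>) \<in> {..m} \<times> {\<tau>. \<tau> permutes {..<m}}. wprod [j..<m] * wprod (nf_word m \<tau>))"
    by (simp add: symsum_def sum_distrib_left sum.cartesian_product)
  also have "\<dots> = symsum (Suc m)"
    unfolding symsum_def
  proof (rule sum.reindex_bij_witness[of _ "\<lambda>\<sigma>. (\<sigma> m, cyc_down (\<sigma> m) m \<circ> \<sigma>)"
        "\<lambda>(j, \<tau>). wordperm [j..<m] \<circ> \<tau>"]; clarsimp)
    fix j \<tau> assume j: "j \<le> m" and \<tau>: "\<tau> permutes {..<m}"
    have fixm: "\<tau> m = m" using \<tau> by (auto simp: permutes_def)
    have "wordperm [j..<m] m = (wordperm [j..<m] \<circ> cyc_down j m) j" by (simp add: cyc_down_def)
    then have wj: "wordperm [j..<m] m = j" by (simp add: wordperm_upt_cyc_down[OF j] del: o_apply)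
    have inv: "cyc_down j m \<circ> (wordperm [j..<m] \<circ> \<tau>) = \<tau>"
      by (simp add: o_assoc cyc_down_wordperm_upt[OF j])
    show "wordperm [j..<m] (\<tau> m) = j \<and>
        cyc_down (wordperm [j..<m] (\<tau> m)) m \<circ> (wordperm [j..<m] \<circ> \<tau>) = \<tau>"
      using inv by (simp add: fixm wj)
    show "wordperm [j..<m] \<circ> \<tau> permutes {..<Suc m}"
      by (intro permutes_compose permutes_wordperm permutes_subset[OF \<tau>]) auto
    show "wprod [wordperm [j..<m] (\<tau> m)..<m] * wprod (nf_word m
        (cyc_down (wordperm [j..<m] (\<tau> m)) m \<circ> (wordperm [j..<m] \<circ> \<tau>))) =
        wprod [j..<m] * wprod (nf_word m \<tau>)"
      using inv by (simp add: fixm wj)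
  next
    fix \<sigma> assume \<sigma>: "\<sigma> permutes {..<Suc m}"
    show "wordperm [\<sigma> m..<m] \<circ> (cyc_down (\<sigma> m) m \<circ> \<sigma>) = \<sigma>"
      by (simp add: o_assoc wordperm_upt_cyc_down cyc_down_comp_permutes[OF \<sigma>])
    show "\<sigma> m \<le> m \<and> cyc_down (\<sigma> m) m \<circ> \<sigma> permutes {..<m}"
      using cyc_down_comp_permutes[OF \<sigma>] by simp
  qed
  finally show ?thesis ..
qed

text \<open>An extra e_m on the left of e_{m+1} is absorbed, and it simplifies the coset words: the
  one with j = m is empty, while each of the m others contributes e_m Q_{m-1}. For m = 0 the
  meaningless \<open>Q (m - 1)\<close> is multiplied by zero.\<close>

lemma symm_Suc:
  assumes m: "m \<le> N"
  shows "of_nat (Suc m) * symm (Suc m) = symm m + of_nat m * (symm m * Q (m - 1) * symm m)"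
proof -
  have abs: "symm m * wprod ws = symm m" if "\<forall>i\<in>set ws. Suc i < m" for ws
    using that m by (induction ws) (auto simp: mult.assoc[symmetric] symm_mult_gen)
  \<comment> \<open>All letters of the coset word but the last lie in the range of e_m and are
    absorbed by it.\<close>
  have "symm m * wprod [j..<m] = symm m * Q (m - 1)" if "j < m" for j
  proof -
    have "[j..<m] = [j..<m - 1] @ [m - 1]" using that by (cases m) auto
    moreover have "symm m * wprod [j..<m - 1] = symm m" by (rule abs) auto
    ultimately show ?thesis by (simp add: mult.assoc[symmetric])
  qed
  then have 1: "(\<Sum>j<m. symm m * wprod [j..<m]) = of_nat m * (symm m * Q (m - 1))" by simp
  have s: "symsum m = of_nat (fact m) * symm m" for m
    using inverse_fact[of m] central[of m]
    by (metis mult.assoc mult_1 symm_def of_nat_fact mult_of_nat_commute)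
  have f: "of_nat (fact (Suc m)) = (of_nat (fact m) * of_nat (Suc m) :: 'a)"
    unfolding fact_Suc of_nat_mult[symmetric] by (simp add: mult.commute)
  have "symm (Suc m) = symm m * symm (Suc m)"
    by (rule symm_absorb_left[symmetric]) (use m in \<open>simp add: gen_mult_symm\<close>)
  also have "of_nat (fact (Suc m)) * \<dots> = symm m * symsum (Suc m)"
    unfolding s by (metis mult.assoc mult_of_nat_commute)
  also have "\<dots> = (\<Sum>j\<le>m. symm m * wprod [j..<m]) * symsum m"
    by (simp add: symsum_Suc sum_distrib_left sum_distrib_right mult.assoc)
  also have "\<dots> = (symm m + of_nat m * (symm m * Q (m - 1))) * (of_nat (fact m) * symm m)"
    unfolding lessThan_Suc_atMost[symmetric] sum.lessThan_Suc 1 s[of m] by (simp add: add.commute)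
  also have "\<dots> = of_nat (fact m) * ((symm m + of_nat m * (symm m * Q (m - 1))) * symm m)"
    by (metis mult.assoc mult_of_nat_commute)
  finally have "of_nat (fact m) * (of_nat (Suc m) * symm (Suc m))
      = of_nat (fact m) * ((symm m + of_nat m * (symm m * Q (m - 1))) * symm m)"
    unfolding f by (simp only: mult.assoc)
  then have "\<kappa> m * of_nat (fact m) * (of_nat (Suc m) * symm (Suc m))
      = \<kappa> m * of_nat (fact m) * ((symm m + of_nat m * (symm m * Q (m - 1))) * symm m)"
    by (simp only: mult.assoc)
  then show ?thesis
    unfolding inverse_fact using symm_idem[of m] m by (simp add: distrib_right mult.assoc)
qed

end

section \<open>Symmetrizers under a trace\<close>

text \<open>The relations are invariant under the flip of the Coxeter diagram of type A. The flip is
  used for the symmetrizer, where the cycle has to occupy the first tensor factors.\<close>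

lemma (in coxeter_gens) coxeter_gens_rev: "coxeter_gens (\<lambda>i. Q (N - 1 - i)) N \<kappa>"
proof
  show "Q (N - 1 - i) * Q (N - 1 - i) = 1" if "i < N" for i
    using that by (intro sq) simp
  show "Q (N - 1 - i) * Q (N - 1 - Suc i) * Q (N - 1 - i)
      = Q (N - 1 - Suc i) * Q (N - 1 - i) * Q (N - 1 - Suc i)" if "Suc i < N" for i
  proof -
    have "N - 1 - i = Suc (N - 1 - Suc i)" using that by simp
    then show ?thesis using braid[of "N - 1 - Suc i"] that by simp
  qed
  show "Q (N - 1 - i) * Q (N - 1 - j) = Q (N - 1 - j) * Q (N - 1 - i)" if "Suc i < j" "j < N" for i j
    using comm[of "N - 1 - j" "N - 1 - i"] that by simp
qed (fact central inverse_fact)+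

text \<open>An idempotent that is an average of words and absorbs all generators is unique.\<close>

lemma (in coxeter_gens) symm_rev:
  "coxeter_gens.symm (\<lambda>i. Q (N - 1 - i)) \<kappa> (Suc N) = symm (Suc N)"
proof -
  interpret R: coxeter_gens "\<lambda>i. Q (N - 1 - i)" N \<kappa> by (rule coxeter_gens_rev)
  have "R.symm (Suc N) * symm (Suc N) = symm (Suc N)"
    by (rule R.symm_absorb_left) (simp add: gen_mult_symm)
  moreover have "R.symm (Suc N) * symm (Suc N) = R.symm (Suc N)"
  proof (rule symm_absorb_right)
    fix i assume "Suc i < Suc N"
    then show "R.symm (Suc N) * Q i = R.symm (Suc N)"
      using R.symm_mult_gen[of "N - 1 - i" "Suc N"] by simp
  qed
  ultimately show ?thesis by simp
qed

text \<open>Cyclicity is required for the generators only: in the application the other argument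
  involves the entries of \<open>M\<close>, which need not commute with one another.\<close>

locale coxeter_trace = coxeter_gens Q N \<kappa>
  for Q :: "nat \<Rightarrow> 'a::ring_1" and N \<kappa> +
  fixes t :: "'a \<Rightarrow> 'b::ring_1"
  assumes trace_add: "t (x + y) = t x + t y"
    and trace_gen: "i < N \<Longrightarrow> t (Q i * y) = t (y * Q i)"
begin

lemma trace_zero [simp]: "t 0 = 0"
  using trace_add[of 0 0] by simp

lemma trace_of_nat: "t (of_nat m * x) = of_nat m * t x"
  by (induction m) (simp_all add: distrib_right trace_add)

lemma trace_wprod: "\<forall>i\<in>set ws. i < N \<Longrightarrow> t (wprod ws * y) = t (y * wprod ws)"
proof (induction ws arbitrary: y)
  case (Cons i ws)
  have "t (wprod (i # ws) * y) = t (wprod ws * (y * Q i))"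
    using Cons.prems by (simp add: mult.assoc trace_gen)
  also have "\<dots> = t (y * Q i * wprod ws)" using Cons by simp
  finally show ?case by (simp add: mult.assoc)
qed simp

lemma trace_sum: "t (\<Sum>x\<in>S. f x) = (\<Sum>x\<in>S. t (f x))"
  by (induction S rule: infinite_finite_induct) (simp_all add: trace_add)

lemma trace_symm:
  assumes "m \<le> Suc N" shows "t (symm m * y) = t (y * symm m)"
proof -
  have "t (symsum m * z) = t (z * symsum m)" for z
    unfolding symsum_def sum_distrib_right sum_distrib_left trace_sum
  proof (rule sum.cong)
    fix \<sigma> assume "\<sigma> \<in> {\<sigma>. \<sigma> permutes {..<m}}"
    then show "t (wprod (nf_word m \<sigma>) * z) = t (z * wprod (nf_word m \<sigma>))"
      using set_nf_word[of \<sigma> m] assms by (intro trace_wprod) fastforce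
  qed simp
  from this[of "y * \<kappa> m"] show ?thesis
    unfolding symm_def by (metis central mult.assoc)
qed

text \<open>The letters of e_m are at most m-2 and those of the word at least m, so any two of them
  are far apart.\<close>

lemma wprod_commute_symm:
  assumes "\<forall>i\<in>set ws. m \<le> i \<and> i < N" shows "wprod ws * symm m = symm m * wprod ws"
proof -
  have "wprod ws * wprod (nf_word m \<sigma>) = wprod (nf_word m \<sigma>) * wprod ws"
    if "\<sigma> permutes {..<m}" for \<sigma>
  proof (rule commute_wprod, rule ballI)
    fix j assume "j \<in> set (nf_word m \<sigma>)"
    then have j: "Suc j < m" using that by (rule set_nf_word[rotated])
    show "wprod ws * Q j = Q j * wprod ws"
      by (rule commute_wprod[symmetric]) (use assms j in \<open>force intro: comm\<close>)
  qed
  then have "wprod ws * symsum m = symsum m * wprod ws"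
    by (simp add: symsum_def sum_distrib_left sum_distrib_right)
  then show ?thesis
    unfolding symm_def by (metis central mult.assoc)
qed

text \<open>The recursion for e_{m+1} is applied repeatedly under the trace. Each application splits
  off one summand, and what remains has the same shape with m lowered and the word prolonged by one
  letter.\<close>

theorem trace_symm_expand_right:
  assumes X: "\<And>i. i < N \<Longrightarrow> (1 + Q i) * X * (1 - Q i) = 0"
  shows "of_nat (Suc N) * t (symm (Suc N) * X)
    = (\<Sum>m<Suc N. t (wprod (rev [m..<N]) * symm m * X))"
proof -
  have abs: "symm m * X * symm m = symm m * X" if m: "m \<le> Suc N" for m
  proof (rule symm_absorb_right)
    fix i assume i: "Suc i < m"
    then have s: "symm m * Q i = symm m" and "i < N" using m by (simp_all add: symm_mult_gen)
    \<comment> \<open>Multiplying the relation by e_m, which absorbs Q_i, leaves twice the desired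
      difference; \<open>\<kappa> 2\<close> then halves it.\<close>
    have "symm m * ((1 + Q i) * X * (1 - Q i)) = (symm m + symm m * Q i) * X * (1 - Q i)"
      by (simp add: algebra_simps)
    also have "\<dots> = 2 * (symm m * X - symm m * X * Q i)"
      by (simp add: s algebra_simps mult_2)
    finally have "of_nat (fact 2) * (symm m * X - symm m * X * Q i) = 0"
      using X[OF \<open>i < N\<close>] by (simp add: numeral_2_eq_2)
    then have "\<kappa> 2 * of_nat (fact 2) * (symm m * X - symm m * X * Q i) = 0"
      by (simp only: mult.assoc mult_zero_right)
    then show "symm m * X * Q i = symm m * X" unfolding inverse_fact by simp
  qed
  \<comment> \<open>The claim is generalised to every stage m of the expansion: at
    \<open>m = Suc N\<close> the word is empty, and at m = 0 both sides vanish.\<close>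
  have "of_nat m * t (wprod (rev [m - 1..<N]) * symm m * X)
      = (\<Sum>l<m. t (wprod (rev [l..<N]) * symm l * X))" if "m \<le> Suc N" for m
    using that
  proof (induction m)
    case (Suc m)
    let ?W = "wprod (rev [m..<N])"
    have W: "?W * symm m = symm m * ?W" by (rule wprod_commute_symm) auto
    \<comment> \<open>The left e_m commutes with the word, travels round the trace to the right of X
      and disappears there by \<open>abs\<close>.\<close>
    have last: "of_nat m * t (?W * symm m * Q (m - 1) * symm m * X)
        = of_nat m * t (wprod (rev [m - 1..<N]) * symm m * X)"
    proof (cases m)
      case (Suc m')
      have "t (?W * symm m * Q (m - 1) * symm m * X) = t (symm m * (?W * Q m' * symm m * X))"
        unfolding W by (simp add: mult.assoc Suc)
      also have "\<dots> = t (?W * Q m' * (symm m * X * symm m))"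
        using Suc.prems by (simp add: trace_symm mult.assoc)
      also have "\<dots> = t (wprod (rev [m - 1..<N]) * symm m * X)"
        unfolding abs[OF Suc_leD[OF Suc.prems]]
        using Suc Suc.prems by (simp add: upt_conv_Cons mult.assoc)
      finally show ?thesis by (simp only:)
    qed simp
    have nat: "?W * (of_nat m * z) = of_nat m * (?W * z)" for z
      by (metis mult.assoc mult_of_nat_commute)
    have "of_nat (Suc m) * t (wprod (rev [Suc m - 1..<N]) * symm (Suc m) * X)
        = t (?W * (of_nat (Suc m) * symm (Suc m)) * X)"
      unfolding trace_of_nat[symmetric] by (simp add: mult.assoc mult_of_nat_commute del: of_nat_Suc)
    also have "\<dots> = t (?W * symm m * X + of_nat m * (?W * symm m * Q (m - 1) * symm m * X))"
      using Suc.prems by (simp add: symm_Suc distrib_left distrib_right mult.assoc nat del: of_nat_Suc)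
    also have "\<dots> = t (?W * symm m * X) + of_nat m * t (wprod (rev [m - 1..<N]) * symm m * X)"
      by (simp only: trace_add trace_of_nat last)
    finally show ?case using Suc by simp
  qed simp
  from this[of "Suc N"] show ?thesis by simp
qed

text \<open>The mirrored relation makes e_m disappear on the left of X instead, giving e_m X e_m = X
  e_m; the expansion otherwise follows the same scheme with ascending words.\<close>

theorem trace_symm_expand_left:
  assumes X: "\<And>i. i < N \<Longrightarrow> (1 - Q i) * X * (1 + Q i) = 0"
  shows "of_nat (Suc N) * t (symm (Suc N) * X)
    = (\<Sum>m<Suc N. t (symm m * wprod [m..<N] * X))"
proof -
  have abs: "symm m * (X * symm m) = X * symm m" if m: "m \<le> Suc N" for m
  proof (rule symm_absorb_left)
    fix i assume i: "Suc i < m"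
    then have s: "Q i * symm m = symm m" and "i < N" using m by (simp_all add: gen_mult_symm)
    have "(1 - Q i) * X * (1 + Q i) * symm m = (1 - Q i) * X * (symm m + Q i * symm m)"
      by (simp add: algebra_simps)
    also have "\<dots> = 2 * (X * symm m - Q i * (X * symm m))"
      by (simp add: s algebra_simps mult_2)
    finally have "of_nat (fact 2) * (X * symm m - Q i * (X * symm m)) = 0"
      using X[OF \<open>i < N\<close>] by (simp add: numeral_2_eq_2)
    then have "\<kappa> 2 * of_nat (fact 2) * (X * symm m - Q i * (X * symm m)) = 0"
      by (simp only: mult.assoc mult_zero_right)
    then show "Q i * (X * symm m) = X * symm m" unfolding inverse_fact by simp
  qed
  have "of_nat m * t (symm m * wprod [m - 1..<N] * X)
      = (\<Sum>l<m. t (symm l * wprod [l..<N] * X))" if "m \<le> Suc N" for m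
    using that
  proof (induction m)
    case (Suc m)
    let ?W = "wprod [m..<N]"
    have W: "?W * symm m = symm m * ?W" by (rule wprod_commute_symm) auto
    \<comment> \<open>Here e_m is cycled twice: first behind X, where it allows the e_m in front of
      X to be removed, and then back to the front.\<close>
    have last: "of_nat m * t (symm m * Q (m - 1) * symm m * ?W * X)
        = of_nat m * t (symm m * wprod [m - 1..<N] * X)"
    proof (cases m)
      case (Suc m')
      have "t (symm m * Q (m - 1) * symm m * ?W * X) = t (symm m * (Q m' * ?W * symm m * X))"
        using W by (simp add: mult.assoc Suc)
      also have "\<dots> = t (Q m' * ?W * (symm m * (X * symm m)))"
        using Suc.prems by (simp add: trace_symm mult.assoc)
      also have "\<dots> = t (Q m' * ?W * X * symm m)"
        using Suc.prems by (simp add: abs mult.assoc)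
      also have "\<dots> = t (symm m * (Q m' * ?W * X))"
        using Suc.prems by (simp add: trace_symm)
      also have "\<dots> = t (symm m * wprod [m - 1..<N] * X)"
        using Suc Suc.prems by (simp add: upt_conv_Cons mult.assoc)
      finally show ?thesis by (simp only:)
    qed simp
    have "of_nat (Suc m) * t (symm (Suc m) * wprod [Suc m - 1..<N] * X)
        = t (of_nat (Suc m) * symm (Suc m) * ?W * X)"
      unfolding trace_of_nat[symmetric] by (simp add: mult.assoc del: of_nat_Suc)
    also have "\<dots> = t (symm m * ?W * X + of_nat m * (symm m * Q (m - 1) * symm m * ?W * X))"
      using Suc.prems by (simp add: symm_Suc distrib_right mult.assoc del: of_nat_Suc)
    also have "\<dots> = t (symm m * ?W * X) + of_nat m * t (symm m * wprod [m - 1..<N] * X)"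
      by (simp only: trace_add trace_of_nat last)
    finally show ?case using Suc by simp
  qed simp
  from this[of "Suc N"] show ?thesis by simp
qed

end

section \<open>Row-finite matrices\<close>

text \<open>The abstract theory needs a type of class \<open>ring_1\<close>, while the size of the
  operators depends on the terms \<open>n\<close> and \<open>k\<close>. Matrices over the whole
  index type with finite rows have well-defined products and form one such ring for all
  \<open>n\<close> and \<open>k\<close>.\<close>

typedef (overloaded) ('i, 'r::zero) rfmat =
  "{f :: 'i \<Rightarrow> 'i \<Rightarrow> 'r. \<forall>u. finite {w. f u w \<noteq> 0}}"
  morphisms entry Abs_rfmat
  by (rule exI[of _ "\<lambda>_ _. 0"]) simp

setup_lifting type_definition_rfmat

lemma finite_entry [simp]: "finite {w. entry X u w \<noteq> 0}"
  using entry[of X] by simp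

lemma rfmat_eqI: "(\<And>u w. entry X u w = entry Y u w) \<Longrightarrow> X = Y"
  by (simp add: entry_inject[symmetric] fun_eq_iff)

instantiation rfmat :: (type, ring_1) ring_1
begin

lift_definition zero_rfmat :: "('a, 'b) rfmat" is "\<lambda>_ _. 0" by simp
lift_definition one_rfmat :: "('a, 'b) rfmat" is "\<lambda>u w. if u = w then 1 else 0" by simp
lift_definition plus_rfmat :: "('a, 'b) rfmat \<Rightarrow> ('a, 'b) rfmat \<Rightarrow> ('a, 'b) rfmat"
  is "\<lambda>X Y u w. X u w + Y u w"
  subgoal for X Y u by (rule finite_subset[of _ "{w. X u w \<noteq> 0} \<union> {w. Y u w \<noteq> 0}"]) auto
  done
lift_definition uminus_rfmat :: "('a, 'b) rfmat \<Rightarrow> ('a, 'b) rfmat"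
  is "\<lambda>X u w. - X u w" by simp
lift_definition minus_rfmat :: "('a, 'b) rfmat \<Rightarrow> ('a, 'b) rfmat \<Rightarrow> ('a, 'b) rfmat"
  is "\<lambda>X Y u w. X u w - Y u w"
  subgoal for X Y u by (rule finite_subset[of _ "{w. X u w \<noteq> 0} \<union> {w. Y u w \<noteq> 0}"]) auto
  done
lift_definition times_rfmat :: "('a, 'b) rfmat \<Rightarrow> ('a, 'b) rfmat \<Rightarrow> ('a, 'b) rfmat"
  is "\<lambda>X Y u w. \<Sum>v | X u v \<noteq> 0. X u v * Y v w"
proof -
  fix X Y :: "'a \<Rightarrow> 'a \<Rightarrow> 'b" and u
  assume "\<And>u. finite {w. X u w \<noteq> 0}" "\<And>u. finite {w. Y u w \<noteq> 0}"
  then have "finite (\<Union>v\<in>{v. X u v \<noteq> 0}. {w. Y v w \<noteq> 0})" by blast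
  moreover have "{w. (\<Sum>v | X u v \<noteq> 0. X u v * Y v w) \<noteq> 0} \<subseteq> (\<Union>v\<in>{v. X u v \<noteq> 0}. {w. Y v w \<noteq> 0})"
  proof
    fix w assume "w \<in> {w. (\<Sum>v | X u v \<noteq> 0. X u v * Y v w) \<noteq> 0}"
    then have "(\<Sum>v | X u v \<noteq> 0. X u v * Y v w) \<noteq> 0" by simp
    then obtain v where "v \<in> {v. X u v \<noteq> 0}" "X u v * Y v w \<noteq> 0"
      by (rule sum.not_neutral_contains_not_neutral)
    then show "w \<in> (\<Union>v\<in>{v. X u v \<noteq> 0}. {w. Y v w \<noteq> 0})" by auto
  qed
  ultimately show "finite {w. (\<Sum>v | X u v \<noteq> 0. X u v * Y v w) \<noteq> 0}" by (rule rev_finite_subset)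
qed

text \<open>The defining sum runs over the support of a row of the left factor. Enlarging it to any
  finite superset lets different products be summed over a common set.\<close>

lemma entry_times:
  assumes "finite S" "\<And>v. entry X u v \<noteq> 0 \<Longrightarrow> v \<in> S"
  shows "entry (X * Y) u w = (\<Sum>v\<in>S. entry X u v * entry Y v w)"
  unfolding times_rfmat.rep_eq
  by (rule sum.mono_neutral_left) (use assms in auto)

instance
proof
  fix X Y Z :: "('a, 'b) rfmat"
  show "X + Y + Z = X + (Y + Z)" "X + Y = Y + X" "0 + X = X" "- X + X = 0" "X - Y = X + - Y"
    by (transfer; simp add: algebra_simps fun_eq_iff)+
  show "(0 :: ('a, 'b) rfmat) \<noteq> 1" by transfer (auto simp: fun_eq_iff)
  show "1 * X = X"
  proof (rule rfmat_eqI)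
    fix u w
    show "entry (1 * X) u w = entry X u w"
      by (subst entry_times[of "{u}"]) (auto simp: one_rfmat.rep_eq split: if_splits)
  qed
  show "X * 1 = X"
  proof (rule rfmat_eqI)
    fix u w
    show "entry (X * 1) u w = entry X u w"
      by (subst entry_times[of "insert w {v. entry X u v \<noteq> 0}"]) (auto simp: one_rfmat.rep_eq if_distrib cong: if_cong)
  qed
  show "(X + Y) * Z = X * Z + Y * Z"
  proof (rule rfmat_eqI)
    fix u w
    let ?S = "{v. entry X u v \<noteq> 0} \<union> {v. entry Y u v \<noteq> 0}"
    have fin: "finite ?S" by simp
    have "entry ((X + Y) * Z) u w = (\<Sum>v\<in>?S. entry (X + Y) u v * entry Z v w)"
      by (rule entry_times[OF fin]) (auto simp: plus_rfmat.rep_eq)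
    also have "\<dots> = entry (X * Z + Y * Z) u w"
      using entry_times[OF fin, of X u Z w] entry_times[OF fin, of Y u Z w]
      by (simp add: plus_rfmat.rep_eq distrib_right sum.distrib)
    finally show "entry ((X + Y) * Z) u w = entry (X * Z + Y * Z) u w" .
  qed
  show "X * (Y + Z) = X * Y + X * Z"
    by transfer (simp add: distrib_left sum.distrib)
  show "X * Y * Z = X * (Y * Z)"
  proof (rule rfmat_eqI)
    fix u w
    let ?S = "{v. entry X u v \<noteq> 0}"
    let ?T = "\<Union>v\<in>?S. {v'. entry Y v v' \<noteq> 0}"
    have fin: "finite ?T" by simp
    have XY: "entry (X * Y) u v' = (\<Sum>v\<in>?S. entry X u v * entry Y v v')" for v'
      by (rule entry_times) auto
    have "entry (X * Y * Z) u w = (\<Sum>v'\<in>?T. entry (X * Y) u v' * entry Z v' w)"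
    proof (rule entry_times[OF fin])
      fix v' assume "entry (X * Y) u v' \<noteq> 0"
      then obtain v where "v \<in> ?S" "entry X u v * entry Y v v' \<noteq> 0"
        unfolding XY by (rule sum.not_neutral_contains_not_neutral)
      then show "v' \<in> ?T" by auto
    qed
    also have "\<dots> = (\<Sum>v\<in>?S. \<Sum>v'\<in>?T. entry X u v * (entry Y v v' * entry Z v' w))"
      unfolding XY sum_distrib_right by (subst sum.swap) (simp add: mult.assoc)
    also have "\<dots> = (\<Sum>v\<in>?S. entry X u v * entry (Y * Z) v w)"
    proof (rule sum.cong[OF refl])
      fix v assume "v \<in> ?S"
      then have "entry (Y * Z) v w = (\<Sum>v'\<in>?T. entry Y v v' * entry Z v' w)"
        by (intro entry_times[OF fin]) auto
      then show "(\<Sum>v'\<in>?T. entry X u v * (entry Y v v' * entry Z v' w)) = entry X u v * entry (Y * Z) v w"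
        by (simp add: sum_distrib_left)
    qed
    also have "\<dots> = entry (X * (Y * Z)) u w"
      by (rule entry_times[symmetric]) auto
    finally show "entry (X * Y * Z) u w = entry (X * (Y * Z)) u w" .
  qed
qed

end

lemma entry_sum: "entry (\<Sum>x\<in>A. f x) u w = (\<Sum>x\<in>A. entry (f x) u w)"
  by (induction A rule: infinite_finite_induct) (simp_all add: zero_rfmat.rep_eq plus_rfmat.rep_eq)

section \<open>Scalar matrices, finite blocks and their traces\<close>

lift_definition diag :: "'r::ring_1 \<Rightarrow> ('i, 'r) rfmat" is "\<lambda>r u w. if u = w then r else 0"
  by simp

lemma entry_diag_times [simp]: "entry (diag r * X) u w = r * entry X u w"
  by (subst entry_times[of "{u}"]) (auto simp: diag.rep_eq split: if_splits)

lemma entry_times_diag [simp]: "entry (X * diag r) u w = entry X u w * r"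
  by (subst entry_times[of "insert w {v. entry X u v \<noteq> 0}"]) (auto simp: diag.rep_eq if_distrib cong: if_cong)

lemma diag_of_nat: "diag (of_nat m) = of_nat m"
proof (rule rfmat_eqI)
  fix u w :: 'a
  show "entry (diag (of_nat m)) u w = entry (of_nat m :: ('a, 'b) rfmat) u w"
    by (induction m) (auto simp: diag.rep_eq zero_rfmat.rep_eq plus_rfmat.rep_eq one_rfmat.rep_eq)
qed

text \<open>The block is completed by the identity, so that relations between operators on the finite
  index set \<open>S\<close> become identities in a unital ring.\<close>

lift_definition block :: "'i set \<Rightarrow> ('i \<Rightarrow> 'i \<Rightarrow> 'r::ring_1) \<Rightarrow> ('i, 'r) rfmat" is
  "\<lambda>S X u w. if finite S \<and> u \<in> S then (if w \<in> S then X u w else 0) else if u = w then 1 else 0"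
  subgoal for S X u by (rule finite_subset[of _ "insert u (if finite S then S else {})"]) auto
  done

lemma entry_block:
  "finite S \<Longrightarrow> entry (block S X) u w
    = (if u \<in> S then (if w \<in> S then X u w else 0) else if u = w then 1 else 0)"
  by (simp add: block.rep_eq)

lemma entry_block_times:
  assumes "finite S"
  shows "entry (block S X * Y) u w = (if u \<in> S then \<Sum>v\<in>S. X u v * entry Y v w else entry Y u w)"
proof (cases "u \<in> S")
  case True
  have "entry (block S X * Y) u w = (\<Sum>v\<in>S. entry (block S X) u v * entry Y v w)"
    by (rule entry_times) (use assms True in \<open>auto simp: entry_block split: if_splits\<close>)
  then show ?thesis using assms True by (simp add: entry_block)
next
  case False
  have "entry (block S X * Y) u w = (\<Sum>v\<in>{u}. entry (block S X) u v * entry Y v w)"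
    by (rule entry_times) (use assms False in \<open>auto simp: entry_block split: if_splits\<close>)
  then show ?thesis using assms False by (simp add: entry_block)
qed

lemma block_cong:
  "(\<And>u w. u \<in> S \<Longrightarrow> w \<in> S \<Longrightarrow> X u w = Y u w) \<Longrightarrow> block S X = block S Y"
  by (rule rfmat_eqI) (simp add: block.rep_eq)

lemma block_times:
  assumes "finite S"
  shows "block S X * block S Y = block S (\<lambda>u w. \<Sum>v\<in>S. X u v * Y v w)"
  by (rule rfmat_eqI) (use assms in \<open>auto simp: entry_block_times entry_block\<close>)

lemma block_one: "block S (\<lambda>u w. if u = w then 1 else 0) = 1"
  by (rule rfmat_eqI) (auto simp: block.rep_eq one_rfmat.rep_eq)

definition block_trace :: "'i set \<Rightarrow> ('i, 'r::ring_1) rfmat \<Rightarrow> 'r" where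
  "block_trace S X = (\<Sum>u\<in>S. entry X u u)"

lemma block_trace_add: "block_trace S (X + Y) = block_trace S X + block_trace S Y"
  by (simp add: block_trace_def plus_rfmat.rep_eq sum.distrib)

text \<open>Exchanging the two summations swaps the factors; for this it suffices that the entries
  of one of them are central.\<close>

lemma block_trace_commute:
  assumes S: "finite S" and X: "\<And>u w r. u \<in> S \<Longrightarrow> w \<in> S \<Longrightarrow> X u w * r = r * X u w"
  shows "block_trace S (block S X * Y) = block_trace S (Y * block S X)"
proof -
  have "entry (Y * block S X) u u = (\<Sum>v\<in>S. entry Y u v * X v u)" if "u \<in> S" for u
  proof -
    let ?T = "S \<union> {v. entry Y u v \<noteq> 0}"
    have "entry (Y * block S X) u u = (\<Sum>v\<in>?T. entry Y u v * entry (block S X) v u)"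
      by (rule entry_times) (use S in auto)
    \<comment> \<open>\<open>Y\<close> may lead out of the block, but a column of
      \<open>block S X\<close> with index in \<open>S\<close> is supported on
      \<open>S\<close>.\<close>
    also have "\<dots> = (\<Sum>v\<in>S. entry Y u v * entry (block S X) v u)"
      by (rule sum.mono_neutral_right) (use S that in \<open>auto simp: entry_block\<close>)
    finally show ?thesis using S that by (simp add: entry_block)
  qed
  moreover have "(\<Sum>u\<in>S. \<Sum>v\<in>S. X u v * entry Y v u) = (\<Sum>u\<in>S. \<Sum>v\<in>S. entry Y u v * X v u)"
    by (subst sum.swap) (simp add: X)
  ultimately show ?thesis
    by (simp add: block_trace_def entry_block_times[OF S])
qed

section \<open>Operators on tensor powers\<close>

lemma finite_idx [simp]: "finite (idx n k)"
proof -
  have "idx n k = {u. set u \<subseteq> {..<n} \<and> length u = k}" by (auto simp: idx_def)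
  then show ?thesis by (simp add: finite_lists_length_eq)
qed

lemma length_idx: "u \<in> idx n k \<Longrightarrow> length u = k"
  by (simp add: idx_def)

lemma append_in_idx: "a \<in> idx n p \<Longrightarrow> x \<in> idx n q \<Longrightarrow> a @ x \<in> idx n (p + q)"
  by (auto simp: idx_def)

lemma idx_split:
  assumes "u \<in> idx n (p + q)"
  obtains a x where "u = a @ x" "a \<in> idx n p" "x \<in> idx n q"
proof
  show "u = take p u @ drop p u" by simp
  show "take p u \<in> idx n p" "drop p u \<in> idx n q"
    using assms by (auto simp: idx_def dest: in_set_takeD in_set_dropD)
qed

lemma sum_idx_add: "(\<Sum>v\<in>idx n (p + q). f v) = (\<Sum>a\<in>idx n p. \<Sum>x\<in>idx n q. f (a @ x))"
proof -
  have "(\<Sum>a\<in>idx n p. \<Sum>x\<in>idx n q. f (a @ x)) = (\<Sum>(a, x)\<in>idx n p \<times> idx n q. f (a @ x))"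
    by (simp add: sum.cartesian_product)
  also have "\<dots> = (\<Sum>v\<in>idx n (p + q). f v)"
    by (rule sum.reindex_bij_witness[of _ "\<lambda>v. (take p v, drop p v)" "\<lambda>(a, x). a @ x"])
      (auto simp: append_in_idx length_idx, auto simp: idx_def dest: in_set_takeD in_set_dropD)
  finally show ?thesis ..
qed

lemma opid_append:
  "length a = length b \<Longrightarrow> opid (a @ x) (b @ y) = (opid a b * opid x y :: 'a::semiring_1)"
  by (auto simp: opid_def)

lemma opid_commute: "opid u w * r = r * (opid u w :: 'a::semiring_1)"
  by (simp add: opid_def)

lemma mmul_opid_left: "u \<in> idx n k \<Longrightarrow> mmul n k opid X u w = (X u w :: 'a::semiring_1)"
  by (simp add: mmul_def opid_def mult_delta_left mult_delta_right)

lemma mmul_opid_right: "w \<in> idx n k \<Longrightarrow> mmul n k X opid u w = (X u w :: 'a::semiring_1)"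
  by (simp add: mmul_def opid_def mult_delta_left mult_delta_right)

lemma mmul_cong:
  "(\<And>v. v \<in> idx n k \<Longrightarrow> X u v = X' u v) \<Longrightarrow> (\<And>v. v \<in> idx n k \<Longrightarrow> Y v w = Y' v w)
    \<Longrightarrow> mmul n k X Y u w = mmul n k X' Y' u w"
  by (simp add: mmul_def)

lemma mmul_assoc: "mmul n k (mmul n k X Y) Z = mmul n k X (mmul n k Y Z)"
  by (intro ext) (simp add: mmul_def sum_distrib_left sum_distrib_right mult.assoc, rule sum.swap)

text \<open>The mixed product rule (X1 \<otimes> Y1)(X2 \<otimes> Y2) = X1 X2 \<otimes> Y1 Y2. Over
  a noncommutative ring the entries of Y1 must pass those of X2. Only the row and the column at hand
  have to factor.\<close>

lemma mmul_append:
  fixes X1 X2 Y1 Y2 :: "'a::semiring_1 op"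
  assumes "\<And>v z. v \<in> idx n p \<Longrightarrow> z \<in> idx n q \<Longrightarrow> Z1 (a @ x) (v @ z) = X1 a v * Y1 x z"
    and "\<And>v z. v \<in> idx n p \<Longrightarrow> z \<in> idx n q \<Longrightarrow> Z2 (v @ z) (b @ y) = X2 v b * Y2 z y"
    and "\<And>v z. v \<in> idx n p \<Longrightarrow> z \<in> idx n q \<Longrightarrow> Y1 x z * X2 v b = X2 v b * Y1 x z"
  shows "mmul n (p + q) Z1 Z2 (a @ x) (b @ y) = mmul n p X1 X2 a b * mmul n q Y1 Y2 x y"
proof -
  have "X1 a v * Y1 x z * (X2 v b * Y2 z y) = X1 a v * X2 v b * (Y1 x z * Y2 z y)"
    if "v \<in> idx n p" "z \<in> idx n q" for v z
    using assms(3)[OF that] by (metis mult.assoc)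
  then show ?thesis
    by (simp add: mmul_def sum_idx_add assms(1,2) sum_product)
qed

lemma Padj_append_left:
  fixes F :: "nat \<Rightarrow> nat \<Rightarrow> nat \<Rightarrow> nat \<Rightarrow> 'a::semiring_1"
  assumes "Suc i < length a" "length a = length b" "length x = length y"
  shows "Padj F i (a @ x) (b @ y) = Padj F i a b * opid x y"
proof -
  have "(\<forall>j<length (a @ x). j \<noteq> i \<and> j \<noteq> Suc i \<longrightarrow> (a @ x) ! j = (b @ y) ! j) \<longleftrightarrow>
      (\<forall>j<length a. j \<noteq> i \<and> j \<noteq> Suc i \<longrightarrow> a ! j = b ! j) \<and> x = y" (is "?L \<longleftrightarrow> ?R")
  proof
    assume L: ?L
    have "x ! j = y ! j" if "j < length x" for j
      using L[rule_format, of "length a + j"] that assms by (simp add: nth_append)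
    then have "x = y" using assms by (simp add: list_eq_iff_nth_eq)
    moreover have "a ! j = b ! j" if "j < length a" "j \<noteq> i" "j \<noteq> Suc i" for j
      using L[rule_format, of j] that assms by (simp add: nth_append)
    ultimately show ?R by blast
  qed (use assms in \<open>auto simp: nth_append\<close>)
  then show ?thesis
    using assms unfolding Padj_def opid_def by (auto simp: nth_append)
qed

lemma Padj_append_right:
  fixes F :: "nat \<Rightarrow> nat \<Rightarrow> nat \<Rightarrow> nat \<Rightarrow> 'a::semiring_1"
  assumes "Suc i < length x" "length a = length b" "length x = length y"
  shows "Padj F (length a + i) (a @ x) (b @ y) = opid a b * Padj F i x y"
proof -
  let ?i = "length a + i"
  have "(\<forall>j<length (a @ x). j \<noteq> ?i \<and> j \<noteq> Suc ?i \<longrightarrow> (a @ x) ! j = (b @ y) ! j) \<longleftrightarrow>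
      a = b \<and> (\<forall>j<length x. j \<noteq> i \<and> j \<noteq> Suc i \<longrightarrow> x ! j = y ! j)" (is "?L \<longleftrightarrow> ?R")
  proof
    assume L: ?L
    have "a ! j = b ! j" if "j < length a" for j
      using L[rule_format, of j] that assms by (simp add: nth_append)
    then have "a = b" using assms by (simp add: list_eq_iff_nth_eq)
    moreover have "x ! j = y ! j" if "j < length x" "j \<noteq> i" "j \<noteq> Suc i" for j
      using L[rule_format, of "length a + j"] that assms by (simp add: nth_append)
    ultimately show ?R by blast
  next
    assume R: ?R
    show ?L
    proof (intro allI impI)
      fix j assume "j < length (a @ x)" "j \<noteq> ?i \<and> j \<noteq> Suc ?i"
      then show "(a @ x) ! j = (b @ y) ! j"
        using R by (cases "j < length a") (auto simp: nth_append not_less dest!: le_Suc_ex)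
    qed
  qed
  then show ?thesis
    using assms unfolding Padj_def opid_def by (auto simp: nth_append)
qed

section \<open>Words of adjacent operators and tensor products\<close>

lemma Pword_Nil [simp]: "Pword n k P [] = opid"
  by (simp add: Pword_def)

lemma Pword_Cons [simp]: "Pword n k P (i # ws) = mmul n k (Padj P i) (Pword n k P ws)"
  by (simp add: Pword_def)

lemma Pword_append:
  assumes "u \<in> idx n k"
  shows "Pword n k P (us @ ws) u w = mmul n k (Pword n k P us) (Pword n k P ws) u w"
  using assms
proof (induction us arbitrary: u)
  case (Cons i us)
  then show ?case by (auto simp: mmul_assoc intro: mmul_cong)
qed (simp add: mmul_opid_left)

text \<open>No letter straddles the cut between the positions p-1 and p, so the two groups of
  letters act on different tensor factors.\<close>

lemma Pword_tensor:
  assumes "a \<in> idx n p" "b \<in> idx n p" "x \<in> idx n q" "y \<in> idx n q"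
    and "\<forall>i\<in>set us. Suc i < p" "\<forall>i\<in>set vs. Suc i < q"
  shows "Pword n (p + q) P (us @ map ((+) p) vs) (a @ x) (b @ y)
    = Pword n p P us a b * Pword n q P vs x y"
  using assms(1,3,5)
proof (induction us arbitrary: a x)
  case Nil
  show ?case using assms(6) Nil(1,2)
  proof (induction vs arbitrary: a x)
    case Nil
    then show ?case using assms(2) by (simp add: opid_append length_idx)
  next
    case (Cons i vs)
    have "mmul n (p + q) (Padj P (p + i)) (Pword n (p + q) P (map ((+) p) vs)) (a @ x) (b @ y)
        = mmul n p opid opid a b * mmul n q (Padj P i) (Pword n q P vs) x y"
    proof (rule mmul_append)
      fix v z assume "v \<in> idx n p" "z \<in> idx n q"
      then show "Padj P (p + i) (a @ x) (v @ z) = opid a v * Padj P i x z"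
        using Padj_append_right[of i x a v z P] Cons.prems by (simp add: length_idx)
    qed (use Cons in auto)
    then show ?case using Cons.prems assms(2) by (simp add: mmul_opid_left)
  qed
next
  case (Cons i us)
  have "mmul n (p + q) (Padj P i) (Pword n (p + q) P (us @ map ((+) p) vs)) (a @ x) (b @ y)
      = mmul n p (Padj P i) (Pword n p P us) a b * mmul n q opid (Pword n q P vs) x y"
    by (rule mmul_append) (use Cons in \<open>auto simp: Padj_append_left length_idx\<close>)
  then show ?case using Cons.prems by (simp add: mmul_opid_left)
qed

lemma Pword_tensor':
  assumes "a \<in> idx n p" "b \<in> idx n p" "x \<in> idx n q" "y \<in> idx n q"
    and "\<forall>i\<in>set us. Suc i < p" "\<forall>i\<in>set vs. Suc i < q"
  shows "Pword n (p + q) P (map ((+) p) vs @ us) (a @ x) (b @ y)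
    = Pword n p P us a b * Pword n q P vs x y"
proof -
  have "Pword n (p + q) P (map ((+) p) vs @ us) (a @ x) (b @ y)
      = mmul n (p + q) (Pword n (p + q) P (map ((+) p) vs)) (Pword n (p + q) P us) (a @ x) (b @ y)"
    using assms by (intro Pword_append append_in_idx)
  also have "\<dots> = mmul n p opid (Pword n p P us) a b * mmul n q (Pword n q P vs) opid x y"
  proof (rule mmul_append)
    fix v z assume vz: "v \<in> idx n p" "z \<in> idx n q"
    show "Pword n (p + q) P (map ((+) p) vs) (a @ x) (v @ z) = opid a v * Pword n q P vs x z"
      using Pword_tensor[of a n p v x q z "[]" vs P] assms vz by simp
    show "Pword n (p + q) P us (v @ z) (b @ y) = Pword n p P us v b * opid z y"
      using Pword_tensor[of v n p b z q y us "[]" P] assms vz by simp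
  qed simp
  also have "\<dots> = Pword n p P us a b * Pword n q P vs x y"
    using assms by (simp add: mmul_opid_left mmul_opid_right)
  finally show ?thesis .
qed

text \<open>Carries an identity between words on q factors to any q consecutive factors among k, the
  others being acted on by the identity. Thus relations known on two or three factors hold
  everywhere.\<close>

lemma Pword_shift_cong:
  assumes eq: "\<And>x y. x \<in> idx n q \<Longrightarrow> y \<in> idx n q \<Longrightarrow> Pword n q P vs x y = Pword n q P vs' x y"
    and vs: "\<forall>j\<in>set vs. Suc j < q" "\<forall>j\<in>set vs'. Suc j < q" and k: "p + q \<le> k"
    and uw: "u \<in> idx n k" "w \<in> idx n k"
  shows "Pword n k P (map ((+) p) vs) u w = Pword n k P (map ((+) p) vs') u w"
proof -
  obtain r where r: "k = p + (q + r)" using k by (metis add.assoc le_Suc_ex)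
  obtain a x e where u: "u = a @ x @ e" "a \<in> idx n p" "x \<in> idx n q" "e \<in> idx n r"
    using uw(1) unfolding r by (metis idx_split)
  obtain b y f where w: "w = b @ y @ f" "b \<in> idx n p" "y \<in> idx n q" "f \<in> idx n r"
    using uw(2) unfolding r by (metis idx_split)
  have "Pword n k P (map ((+) p) ws) u w = opid a b * (Pword n q P ws x y * opid e f)"
    if "\<forall>j\<in>set ws. Suc j < q" for ws
    using Pword_tensor[of a n p b "x @ e" "q + r" "y @ f" "[]" ws P]
      Pword_tensor[of x n q y e r f ws "[]" P] that u w
    by (fastforce simp: r append_in_idx)
  then show ?thesis using eq[of x y] vs u w by simp
qed

lemma Mprod_append:
  "length a = length b \<Longrightarrow> Mprod M (a @ x) (b @ y) = Mprod M a b * Mprod M x y"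
  by (simp add: Mprod_def)

section \<open>Manin matrices\<close>

lemma sum_idx_Suc: "(\<Sum>v\<in>idx n (Suc r). f v) = (\<Sum>a\<in>idx n r. \<Sum>x<n. f (a @ [x]))"
proof -
  have "(\<Sum>x\<in>idx n 1. g x) = (\<Sum>x<n. g [x])" for g :: "nat list \<Rightarrow> 'a"
    by (rule sum.reindex_bij_witness[of _ "\<lambda>x. [x]" hd]) (auto simp: idx_def length_Suc_conv)
  then show ?thesis using sum_idx_add[of f n r 1] by simp
qed

locale manin_matrix =
  fixes c :: "complex \<Rightarrow> 'r::ring_1"
    and n :: nat
    and A :: "nat \<Rightarrow> nat \<Rightarrow> nat \<Rightarrow> nat \<Rightarrow> complex"
    and M :: "nat \<Rightarrow> nat \<Rightarrow> 'r"
  assumes c_one: "c 1 = 1"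
    and c_add: "\<And>x y. c (x + y) = c x + c y"
    and c_mult: "\<And>x y. c (x * y) = c x * c y"
    and c_central: "\<And>x r. c x * r = r * c x"
    and A_idem: "\<forall>u\<in>idx n 2. \<forall>w\<in>idx n 2. mmul n 2 (op2 A) (op2 A) u w = op2 A u w"
    and braid: "\<forall>u\<in>idx n 3. \<forall>w\<in>idx n 3.
       mmul n 3 (mmul n 3 (Padj (PA A) 0) (Padj (PA A) 1)) (Padj (PA A) 0) u w =
       mmul n 3 (mmul n 3 (Padj (PA A) 1) (Padj (PA A) 0)) (Padj (PA A) 1) u w"
    and Manin: "is_Manin c n A M"
begin

abbreviation "P \<equiv> PA A"

section \<open>The structure map and the Coxeter relations for P_A\<close>

lemma c_zero [simp]: "c 0 = 0"
  using c_add[of 0 0] by simp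

lemma c_diff: "c (x - y) = c x - c y"
  using c_add[of "x - y" y] by (simp add: algebra_simps)

lemma c_uminus: "c (- x) = - c x"
  using c_diff[of 0 x] by simp

lemma c_sum: "c (\<Sum>x\<in>S. f x) = (\<Sum>x\<in>S. c (f x))"
  by (induction S rule: infinite_finite_induct) (simp_all add: c_add)

lemma c_opid: "c (opid u w) = opid u w"
  by (simp add: opid_def c_one)

lemma c_of_nat: "c (of_nat m) = of_nat m"
  by (induction m) (simp_all add: c_add c_one)

text \<open>Only two factors require computation, where (1 - 2A)^2 = 1 - 4A + 4A^2 and A is
  idempotent.\<close>

lemma Pword_sq:
  assumes "Suc i < k" "u \<in> idx n k" "w \<in> idx n k"
  shows "Pword n k P [i, i] u w = opid u w"
proof -
  have base: "Pword n 2 P [0, 0] x y = Pword n 2 P [] x y" if xy: "x \<in> idx n 2" "y \<in> idx n 2" for x y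
  proof -
    have P2: "Padj P 0 u w = opid u w - 2 * op2 A u w" if "u \<in> idx n 2" "w \<in> idx n 2" for u w
      using that by (auto simp: Padj_def PA_def op2_def opid_def idx_def list_eq_iff_nth_eq less_2_cases_iff)
    have "Pword n 2 P [0, 0] x y = mmul n 2 (Padj P 0) (Padj P 0) x y"
      using xy by (auto intro!: mmul_cong simp: mmul_opid_right)
    also have "\<dots> = (\<Sum>v\<in>idx n 2. opid x v * opid v y - 2 * (opid x v * op2 A v y)
        - 2 * (op2 A x v * opid v y) + 4 * (op2 A x v * op2 A v y))"
      unfolding mmul_def using xy by (intro sum.cong) (auto simp: P2 algebra_simps)
    also have "\<dots> = mmul n 2 opid opid x y - 2 * mmul n 2 opid (op2 A) x y
        - 2 * mmul n 2 (op2 A) opid x y + 4 * mmul n 2 (op2 A) (op2 A) x y"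
      by (simp add: mmul_def sum.distrib sum_subtractf sum_distrib_left)
    also have "\<dots> = opid x y"
      using xy A_idem by (simp add: mmul_opid_left mmul_opid_right)
    finally show ?thesis by simp
  qed
  show ?thesis
    using Pword_shift_cong[of n 2 P "[0, 0]" "[]" i k u w, OF base] assms by simp
qed

lemma Pword_braid:
  assumes "Suc (Suc i) < k" "u \<in> idx n k" "w \<in> idx n k"
  shows "Pword n k P [i, Suc i, i] u w = Pword n k P [Suc i, i, Suc i] u w"
proof -
  have base: "Pword n 3 P [0, 1, 0] x y = Pword n 3 P [1, 0, 1] x y"
    if xy: "x \<in> idx n 3" "y \<in> idx n 3" for x y
  proof -
    have "Pword n 3 P [l, j, l] x y = mmul n 3 (mmul n 3 (Padj P l) (Padj P j)) (Padj P l) x y" for l j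
      unfolding mmul_assoc using xy by (auto intro!: mmul_cong simp: mmul_opid_right)
    then show ?thesis using braid xy by simp
  qed
  show ?thesis
    using Pword_shift_cong[of n 3 P "[0, 1, 0]" "[1, 0, 1]" i k u w, OF base] assms by simp
qed

text \<open>Cutting after position i+1 separates the two letters, and both orders give the same
  tensor product.\<close>

lemma Pword_comm:
  assumes "Suc i < j" "Suc j < k" "u \<in> idx n k" "w \<in> idx n k"
  shows "Pword n k P [i, j] u w = Pword n k P [j, i] u w"
proof -
  define q where "q = k - (i + 2)"
  define l where "l = j - (i + 2)"
  have k: "k = (i + 2) + q" and j: "j = (i + 2) + l" and l: "Suc l < q"
    using assms by (auto simp: q_def l_def)
  obtain a x where u: "u = a @ x" "a \<in> idx n (i + 2)" "x \<in> idx n q"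
    using assms(3) unfolding k by (rule idx_split)
  obtain b y where w: "w = b @ y" "b \<in> idx n (i + 2)" "y \<in> idx n q"
    using assms(4) unfolding k by (rule idx_split)
  show ?thesis
    using Pword_tensor[of a n "i + 2" b x q y "[i]" "[l]" P] u w l
      Pword_tensor'[of a n "i + 2" b x q y "[i]" "[l]" P]
    unfolding k j by simp
qed

text \<open>The sign \<open>s = 1\<close> leads to the symmetrizer \<open>S\<^sup>(\<^sup>k\<^sup>)\<close> and \<open>s = -1\<close> to \<open>A\<^sup>(\<^sup>k\<^sup>)\<close>, because \<open>-P\<^sub>A\<close>
  satisfies the same relations as \<open>P\<^sub>A\<close>.\<close>

definition gen :: "complex \<Rightarrow> nat \<Rightarrow> nat \<Rightarrow> (nat list, 'r) rfmat" where
  "gen s k i = block (idx n k) (\<lambda>u w. c (s * Padj P i u w))"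

definition inv_fact :: "nat \<Rightarrow> (nat list, 'r) rfmat" where
  "inv_fact m = diag (c (1 / fact m))"

lemma prod_gen:
  "prod_list (map (gen s k) ws) = block (idx n k) (\<lambda>u w. c (s ^ length ws * Pword n k P ws u w))"
proof (induction ws)
  case Nil
  show ?case by (simp add: c_opid) (simp add: opid_def block_one)
next
  case (Cons i ws)
  have "prod_list (map (gen s k) (i # ws)) = block (idx n k)
      (\<lambda>u w. \<Sum>v\<in>idx n k. c (s * Padj P i u v) * c (s ^ length ws * Pword n k P ws v w))"
    by (simp only: list.map prod_list.Cons Cons.IH) (simp only: gen_def block_times finite_idx)
  also have "\<dots> = block (idx n k) (\<lambda>u w. c (s ^ length (i # ws) * Pword n k P (i # ws) u w))"
    by (rule block_cong)
      (simp add: mmul_def sum_distrib_left c_sum c_mult[symmetric] mult.assoc mult.left_commute)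
  finally show ?case .
qed

lemma prod_gen_cong:
  assumes "\<And>u w. u \<in> idx n k \<Longrightarrow> w \<in> idx n k \<Longrightarrow> Pword n k P ws u w = Pword n k P ws' u w"
    and "s ^ length ws = s ^ length ws'"
  shows "prod_list (map (gen s k) ws) = prod_list (map (gen s k) ws')"
  unfolding prod_gen by (rule block_cong) (simp add: assms)

lemma coxeter_gens_gen:
  assumes s: "s * s = 1"
  shows "coxeter_gens (gen s k) (k - 1) inv_fact"
proof
  show "gen s k i * gen s k i = 1" if "i < k - 1" for i
    using prod_gen_cong[of k "[i, i]" "[]" s] Pword_sq[of i k] that s by simp
  show "gen s k i * gen s k (Suc i) * gen s k i = gen s k (Suc i) * gen s k i * gen s k (Suc i)"
    if "Suc i < k - 1" for i
    using prod_gen_cong[of k "[i, Suc i, i]" "[Suc i, i, Suc i]" s] Pword_braid[of i k] that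
    by (simp add: mult.assoc)
  show "gen s k i * gen s k j = gen s k j * gen s k i" if "Suc i < j" "j < k - 1" for i j
    using prod_gen_cong[of k "[i, j]" "[j, i]" s] Pword_comm[of i j k] that by simp
  show "inv_fact m * X = X * inv_fact m" for m X
    by (rule rfmat_eqI) (simp add: inv_fact_def c_central)
  show "inv_fact m * of_nat (fact m) = 1" for m
  proof (rule rfmat_eqI)
    fix u w
    have "c (1 / fact m) * of_nat (fact m) = c (1 / fact m * of_nat (fact m))"
      by (simp only: c_mult c_of_nat)
    then have "c (1 / fact m) * of_nat (fact m) = 1" by (simp add: c_one)
    then show "entry (inv_fact m * of_nat (fact m)) u w = entry (1 :: (nat list, 'r) rfmat) u w"
      unfolding diag_of_nat[symmetric] inv_fact_def entry_diag_times diag.rep_eq one_rfmat.rep_eq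
      by simp
  qed
qed

section \<open>Identification of S^(k) and A^(k) with symmetrizers of generators\<close>

lemma coxeter_trace_gen:
  assumes s: "s * s = 1"
  shows "coxeter_trace (gen s k) (k - 1) inv_fact (block_trace (idx n k))"
proof -
  interpret coxeter_gens "gen s k" "k - 1" inv_fact by (rule coxeter_gens_gen[OF s])
  show ?thesis
    by unfold_locales (auto simp: block_trace_add gen_def intro!: block_trace_commute c_central)
qed

text \<open>The word chosen in \<open>Pperm\<close> is immaterial because products of generators
  depend only on the permutation. This is known in the matrix ring over the algebra, so the equality
  is obtained after applying \<open>c\<close>.\<close>

lemma c_Pperm:
  assumes "\<sigma> permutes {..<k}" "u \<in> idx n k" "w \<in> idx n k"
  shows "c (Pperm n k P \<sigma> u w) = c (Pword n k P (nf_word k \<sigma>) u w)"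
proof -
  interpret coxeter_gens "gen 1 k" "k - 1" inv_fact by (rule coxeter_gens_gen) simp
  define ws where "ws = (SOME ws. (\<forall>i\<in>set ws. Suc i < k) \<and> wordperm ws = \<sigma>)"
  have "(\<forall>i\<in>set ws. Suc i < k) \<and> wordperm ws = \<sigma>"
    unfolding ws_def
    by (rule someI[of _ "nf_word k \<sigma>"]) (use assms(1) in \<open>auto simp: wordperm_nf_word set_nf_word\<close>)
  then have "wprod ws = wprod (nf_word k \<sigma>)" using wprod_word[of k ws] by simp
  then have "entry (wprod ws) u w = entry (wprod (nf_word k \<sigma>)) u w" by simp
  then show ?thesis
    using assms by (simp add: wprod_def prod_gen entry_block Pperm_def ws_def)
qed

text \<open>A common form of both symmetrizers: the power of \<open>s\<close> is 1 for s = 1 and the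
  sign of the permutation for s = -1, since \<open>sign\<close> is determined by the parity of the
  word length.\<close>

definition csym :: "complex \<Rightarrow> nat \<Rightarrow> complex op" where
  "csym s m u w = 1 / fact m *
    (\<Sum>\<sigma> | \<sigma> permutes {..<m}. s ^ length (nf_word m \<sigma>) * Pword n m P (nf_word m \<sigma>) u w)"

lemma c_Ssym:
  assumes "u \<in> idx n k" "w \<in> idx n k" shows "c (Ssym n k P u w) = c (csym 1 k u w)"
  unfolding Ssym_def csym_def c_mult c_sum using assms by (simp add: c_Pperm c_one)

lemma c_Asym:
  assumes "u \<in> idx n k" "w \<in> idx n k" shows "c (Asym n k P u w) = c (csym (- 1) k u w)"
proof -
  have "of_int (sign \<sigma>) = ((- 1) ^ length (nf_word k \<sigma>) :: complex)" if "\<sigma> permutes {..<k}" for \<sigma>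
    using sign_wordperm[of "nf_word k \<sigma>"] wordperm_nf_word[OF that] by simp
  then show ?thesis
    unfolding Asym_def csym_def c_mult c_sum using assms by (simp add: c_Pperm)
qed

lemma entry_symm:
  assumes s: "s * s = 1" and "u \<in> idx n k" "w \<in> idx n k"
  shows "entry (coxeter_gens.symm (gen s k) inv_fact k) u w = c (csym s k u w)"
proof -
  interpret coxeter_gens "gen s k" "k - 1" inv_fact by (rule coxeter_gens_gen[OF s])
  show ?thesis
    unfolding csym_def c_mult c_sum
    using assms by (simp add: symm_def symsum_def inv_fact_def entry_sum wprod_def prod_gen entry_block c_mult)
qed

text \<open>The star power is the partial trace, over the first r of r+1 factors, of the word r-1,
  ..., 0 times M_1 ... M_{r+1}. One more star product with \<open>M\<close> prepends the letter r,
  appends a factor and traces out the formerly last one.\<close>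

lemma Mbr_eq:
  assumes "i < n"
  shows "Mbr c n P M (Suc r) i j = (\<Sum>a\<in>idx n r. \<Sum>v\<in>idx n (Suc r).
    c (Pword n (Suc r) P (rev [0..<r]) (a @ [i]) v) * Mprod M v (a @ [j]))"
  using assms
proof (induction r arbitrary: i j)
  case 0
  have "(\<Sum>v\<in>idx n 1. c (opid [i] v) * Mprod M v [j]) = M i j"
    using mmul_opid_left[of "[i]" n 1 "Mprod M" "[j]"] 0 by (simp add: mmul_def c_opid idx_def Mprod_def)
  moreover have "idx n 0 = {[]}" by (auto simp: idx_def)
  ultimately show ?case by simp
next
  case (Suc r)
  let ?W = "rev [0..<r]"
  \<comment> \<open>The new letter acts on the last two positions only and the old word leaves the
    last one alone, so of the intermediate index just the entry p remains to be summed.\<close>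
  have W: "Pword n (Suc (Suc r)) P (r # ?W) ((b @ [a]) @ [i]) (v @ [q])
      = (\<Sum>p<n. P a i p q * Pword n (Suc r) P ?W (b @ [p]) v)"
    if "a < n" "b \<in> idx n r" "v \<in> idx n (Suc r)" "q < n" for a b v q
  proof -
    have "Pword n (Suc (Suc r)) P (r # ?W) ((b @ [a]) @ [i]) (v @ [q])
        = (\<Sum>b'\<in>idx n r. \<Sum>p<n. \<Sum>q'<n. Padj P r ((b @ [a]) @ [i]) ((b' @ [p]) @ [q'])
            * Pword n (Suc (Suc r)) P ?W ((b' @ [p]) @ [q']) (v @ [q]))"
      by (simp add: mmul_def sum_idx_Suc)
    also have "\<dots> = (\<Sum>b'\<in>idx n r. \<Sum>p<n. \<Sum>q'<n. opid b b' * P a i p q'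
            * (Pword n (Suc r) P ?W (b' @ [p]) v * opid [q'] [q]))"
    proof (intro sum.cong refl)
      fix b' p q' assume *: "b' \<in> idx n r" "p \<in> {..<n}" "q' \<in> {..<n}"
      have "Padj P r ((b @ [a]) @ [i]) ((b' @ [p]) @ [q']) = opid b b' * Padj P 0 [a, i] [p, q']"
        using Padj_append_right[of 0 "[a, i]" b b' "[p, q']" P] that * by (simp add: length_idx)
      also have "Padj P 0 [a, i] [p, q'] = P a i p q'"
        by (auto simp: Padj_def less_Suc_eq)
      finally have 1: "Padj P r ((b @ [a]) @ [i]) ((b' @ [p]) @ [q']) = opid b b' * P a i p q'" .
      have 2: "Pword n (Suc (Suc r)) P ?W ((b' @ [p]) @ [q']) (v @ [q])
          = Pword n (Suc r) P ?W (b' @ [p]) v * opid [q'] [q]"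
        using Pword_tensor[of "b' @ [p]" n "Suc r" v "[q']" 1 "[q]" ?W "[]" P] that *
        by (simp add: idx_def)
      show "Padj P r ((b @ [a]) @ [i]) ((b' @ [p]) @ [q'])
            * Pword n (Suc (Suc r)) P ?W ((b' @ [p]) @ [q']) (v @ [q])
          = opid b b' * P a i p q' * (Pword n (Suc r) P ?W (b' @ [p]) v * opid [q'] [q])"
        by (simp only: 1 2)
    qed
    also have "\<dots> = (\<Sum>p<n. P a i p q * Pword n (Suc r) P ?W (b @ [p]) v)"
    proof -
      have "(\<Sum>p<n. \<Sum>q'<n. opid b b' * P a i p q' * (Pword n (Suc r) P ?W (b' @ [p]) v * opid [q'] [q]))
          = (if b = b' then \<Sum>p<n. P a i p q * Pword n (Suc r) P ?W (b @ [p]) v else 0)" for b'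
        using that by (simp add: opid_def mult_delta_right)
      then show ?thesis using that by simp
    qed
    finally show ?thesis .
  qed
  \<comment> \<open>Brings the indices of the star product outside and those of the inner partial
    trace inside, where the induction hypothesis applies.\<close>
  have swap: "(\<Sum>b\<in>B. \<Sum>a\<in>C. \<Sum>v\<in>V. \<Sum>q\<in>D. \<Sum>p\<in>E. F b a v q p)
      = (\<Sum>a\<in>C. \<Sum>p\<in>E. \<Sum>q\<in>D. \<Sum>b\<in>B. \<Sum>v\<in>V. F b a v q p)"
    for B C D E V and F :: "nat list \<Rightarrow> nat \<Rightarrow> nat list \<Rightarrow> nat \<Rightarrow> nat \<Rightarrow> 'r"
  proof -
    have "(\<Sum>v\<in>V. \<Sum>q\<in>D. \<Sum>p\<in>E. F b a v q p) = (\<Sum>p\<in>E. \<Sum>q\<in>D. \<Sum>v\<in>V. F b a v q p)" for a b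
      by (simp add: sum.swap[of _ D V] sum.swap[of _ D E] sum.swap[of _ E V])
    then have "(\<Sum>b\<in>B. \<Sum>a\<in>C. \<Sum>v\<in>V. \<Sum>q\<in>D. \<Sum>p\<in>E. F b a v q p)
        = (\<Sum>a\<in>C. \<Sum>b\<in>B. \<Sum>p\<in>E. \<Sum>q\<in>D. \<Sum>v\<in>V. F b a v q p)"
      by (simp add: sum.swap[of _ C B])
    then show ?thesis by (simp add: sum.swap[of _ E B] sum.swap[of _ D B])
  qed
  have "(\<Sum>d\<in>idx n (Suc r). \<Sum>v\<in>idx n (Suc (Suc r)).
        c (Pword n (Suc (Suc r)) P (r # ?W) (d @ [i]) v) * Mprod M v (d @ [j]))
      = (\<Sum>b\<in>idx n r. \<Sum>a<n. \<Sum>v\<in>idx n (Suc r). \<Sum>q<n.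
          c (Pword n (Suc (Suc r)) P (r # ?W) ((b @ [a]) @ [i]) (v @ [q])) * Mprod M (v @ [q]) ((b @ [a]) @ [j]))"
    by (simp only: sum_idx_Suc[of _ n "Suc r"]) (rule sum_idx_Suc)
  also have "\<dots> = (\<Sum>b\<in>idx n r. \<Sum>a<n. \<Sum>v\<in>idx n (Suc r). \<Sum>q<n. \<Sum>p<n.
          c (P a i p q) * (c (Pword n (Suc r) P ?W (b @ [p]) v) * Mprod M v (b @ [a])) * M q j)"
  proof (intro sum.cong refl)
    fix b a v q assume *: "b \<in> idx n r" "a \<in> {..<n}" "v \<in> idx n (Suc r)" "q \<in> {..<n}"
    have "Mprod M (v @ [q]) ((b @ [a]) @ [j]) = Mprod M v (b @ [a]) * M q j"
      using * Mprod_append[of v "b @ [a]" M "[q]" "[j]"] by (simp add: length_idx Mprod_def)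
    then show "c (Pword n (Suc (Suc r)) P (r # ?W) ((b @ [a]) @ [i]) (v @ [q])) * Mprod M (v @ [q]) ((b @ [a]) @ [j])
        = (\<Sum>p<n. c (P a i p q) * (c (Pword n (Suc r) P ?W (b @ [p]) v) * Mprod M v (b @ [a])) * M q j)"
      using W[of a b v q] * by (simp only: c_sum c_mult sum_distrib_right mult.assoc lessThan_iff)
  qed
  also have "\<dots> = (\<Sum>a<n. \<Sum>p<n. \<Sum>q<n. c (P a i p q) * Mbr c n P M (Suc r) p a * M q j)"
    unfolding swap by (simp add: Suc.IH sum_distrib_left sum_distrib_right)
  finally show ?case by (simp add: starP_def)
qed

lemma trace_Mbr:
  "(\<Sum>i<n. Mbr c n P M (Suc r) i i)
    = trk n (Suc r) (mmul n (Suc r) (cop c (Pword n (Suc r) P (rev [0..<r]))) (Mprod M))"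
  by (simp add: Mbr_eq trk_def mmul_def cop_def sum.swap[of _ "idx n r"]) (rule sum_idx_Suc[symmetric])

section \<open>The Manin relation on neighbouring factors\<close>

definition manin_op :: "nat \<Rightarrow> nat \<Rightarrow> 'r op" where
  "manin_op k i = mmul n k (mmul n k (cop c (Padj A i)) (Mprod M)) (\<lambda>u w. opid u w - cop c (Padj A i) u w)"

lemma manin_op_append_right:
  assumes "a \<in> idx n p" "b \<in> idx n p" "x \<in> idx n q" "y \<in> idx n q" "Suc i < q"
  shows "manin_op (p + q) (p + i) (a @ x) (b @ y) = Mprod M a b * manin_op q i x y"
proof -
  have A: "cop c (Padj A (p + i)) (a @ x) (b @ y) = opid a b * cop c (Padj A i) x y"
    if "a \<in> idx n p" "b \<in> idx n p" "x \<in> idx n q" "y \<in> idx n q" for a b x y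
    using Padj_append_right[of i x a b y A] that assms(5) by (simp add: cop_def length_idx c_mult c_opid)
  have 1: "mmul n (p + q) (cop c (Padj A (p + i))) (Mprod M) (a @ x) (v @ z)
      = Mprod M a v * mmul n q (cop c (Padj A i)) (Mprod M) x z"
    if "v \<in> idx n p" "z \<in> idx n q" for v z
  proof -
    have "mmul n (p + q) (cop c (Padj A (p + i))) (Mprod M) (a @ x) (v @ z)
        = mmul n p opid (Mprod M) a v * mmul n q (cop c (Padj A i)) (Mprod M) x z"
      by (rule mmul_append)
        (use assms that in \<open>simp_all add: A Mprod_append length_idx, simp add: cop_def c_central\<close>)
    then show ?thesis using assms by (simp add: mmul_opid_left)
  qed
  have "manin_op (p + q) (p + i) (a @ x) (b @ y) = mmul n p (Mprod M) opid a b * manin_op q i x y"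
    unfolding manin_op_def
    by (rule mmul_append, use assms in \<open>simp_all add: 1 A opid_append length_idx right_diff_distrib\<close>)
      (rule opid_commute[symmetric])
  then show ?thesis using assms by (simp add: mmul_opid_right)
qed

lemma manin_op_append_left:
  assumes "a \<in> idx n p" "b \<in> idx n p" "x \<in> idx n q" "y \<in> idx n q" "Suc i < p"
  shows "manin_op (p + q) i (a @ x) (b @ y) = manin_op p i a b * Mprod M x y"
proof -
  have A: "cop c (Padj A i) (a @ x) (b @ y) = cop c (Padj A i) a b * opid x y"
    if "a \<in> idx n p" "b \<in> idx n p" "x \<in> idx n q" "y \<in> idx n q" for a b x y
    using Padj_append_left[of i a b x y A] that assms(5) by (simp add: cop_def length_idx c_mult c_opid)
  have 1: "mmul n (p + q) (cop c (Padj A i)) (Mprod M) (a @ x) (v @ z)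
      = mmul n p (cop c (Padj A i)) (Mprod M) a v * Mprod M x z"
    if "v \<in> idx n p" "z \<in> idx n q" for v z
  proof -
    have "mmul n (p + q) (cop c (Padj A i)) (Mprod M) (a @ x) (v @ z)
        = mmul n p (cop c (Padj A i)) (Mprod M) a v * mmul n q opid (Mprod M) x z"
      by (rule mmul_append) (use assms that in \<open>simp_all add: A Mprod_append length_idx opid_commute\<close>)
    then show ?thesis using assms by (simp add: mmul_opid_left)
  qed
  have "manin_op (p + q) i (a @ x) (b @ y) = manin_op p i a b * mmul n q (Mprod M) opid x y"
    unfolding manin_op_def
  proof (rule mmul_append)
    fix v z assume vz: "v \<in> idx n p" "z \<in> idx n q"
    show "opid (v @ z) (b @ y) - cop c (Padj A i) (v @ z) (b @ y)
        = (opid v b - cop c (Padj A i) v b) * opid z y"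
      using assms vz by (simp add: A opid_append length_idx algebra_simps)
    show "Mprod M x z * (opid v b - cop c (Padj A i) v b) = (opid v b - cop c (Padj A i) v b) * Mprod M x z"
      by (simp add: left_diff_distrib right_diff_distrib cop_def opid_commute c_central)
  qed (use assms in \<open>simp add: 1\<close>)
  then show ?thesis using assms by (simp add: mmul_opid_right)
qed

text \<open>Writing k = i + 2 + r, the entries of \<open>M\<close> on the outer positions split off
  on either side, and the Manin relation on two factors remains in the middle.\<close>

lemma manin_op_zero:
  assumes "Suc i < k" "u \<in> idx n k" "w \<in> idx n k"
  shows "manin_op k i u w = 0"
proof -
  obtain r where r: "k = i + (2 + r)" using assms(1) by (metis add_2_eq_Suc less_iff_Suc_add add_Suc_right add_Suc)
  obtain a x e where u: "u = a @ x @ e" "a \<in> idx n i" "x \<in> idx n 2" "e \<in> idx n r"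
    using assms(2) unfolding r by (metis idx_split)
  obtain b y f where w: "w = b @ y @ f" "b \<in> idx n i" "y \<in> idx n 2" "f \<in> idx n r"
    using assms(3) unfolding r by (metis idx_split)
  have P2: "Padj A 0 u w = op2 A u w" if "u \<in> idx n 2" "w \<in> idx n 2" for u w
    using that by (auto simp: Padj_def op2_def idx_def less_2_cases_iff)
  have "manin_op 2 0 x y = mmul n 2 (mmul n 2 (cop c (op2 A)) (Mprod M))
       (cop c (\<lambda>u w. opid u w - op2 A u w)) x y"
    unfolding manin_op_def using u w
    by (intro mmul_cong) (auto simp: cop_def P2 c_diff c_opid)
  also have "\<dots> = 0" using Manin u w by (simp add: is_Manin_def)
  finally have "manin_op (2 + r) 0 (x @ e) (y @ f) = 0"
    using manin_op_append_left[of x 2 y e r f 0] u w by simp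
  then show ?thesis
    using manin_op_append_right[of a i b "x @ e" "2 + r" "y @ f" 0] u w r
      append_in_idx[of x n 2 e r] append_in_idx[of y n 2 f r] by simp
qed

text \<open>This is (1 - P) M (1 + P) = 0 multiplied out, where 1 - P = 2A and 1 + P = 2(1 - A). The
  proof uses the Manin relation in the form A M A = A M.\<close>

lemma manin_block:
  assumes "Suc i < k" "u \<in> idx n k" "w \<in> idx n k"
  defines "p \<equiv> cop c (Padj P i)"
  shows "Mprod M u w + mmul n k (Mprod M) p u w - mmul n k p (Mprod M) u w
    - mmul n k (mmul n k p (Mprod M)) p u w = 0"
proof -
  define a where "a = cop c (Padj A i)"
  have p: "p u w = opid u w - (a u w + a u w)" if "u \<in> idx n k" "w \<in> idx n k" for u w
  proof -
    have "Padj P i u w = opid u w - (Padj A i u w + Padj A i u w)"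
      using that assms(1) by (auto simp: Padj_def PA_def opid_def idx_def list_eq_iff_nth_eq)
    then show ?thesis by (simp only: p_def a_def cop_def c_add c_diff c_opid)
  qed
  have R: "mmul n k X p u w = X u w - (mmul n k X a u w + mmul n k X a u w)"
    if "w \<in> idx n k" for X u w
  proof -
    have "mmul n k X p u w = mmul n k X opid u w - (mmul n k X a u w + mmul n k X a u w)"
      using that by (simp add: mmul_def p algebra_simps sum.distrib sum_subtractf)
    then show ?thesis using that by (simp add: mmul_opid_right)
  qed
  have L: "mmul n k p X u w = X u w - (mmul n k a X u w + mmul n k a X u w)"
    if "u \<in> idx n k" for X u w
  proof -
    have "mmul n k p X u w = mmul n k opid X u w - (mmul n k a X u w + mmul n k a X u w)"
      using that by (simp add: mmul_def p algebra_simps sum.distrib sum_subtractf)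
    then show ?thesis using that by (simp add: mmul_opid_left)
  qed
  have "manin_op k i u w = mmul n k (mmul n k a (Mprod M)) opid u w
      - mmul n k (mmul n k a (Mprod M)) a u w"
    by (simp add: manin_op_def a_def[symmetric] mmul_def[of _ _ "mmul n k a (Mprod M)"]
        right_diff_distrib sum_subtractf)
  then have "mmul n k (mmul n k a (Mprod M)) a u w = mmul n k a (Mprod M) u w"
    using manin_op_zero[OF assms(1-3)] assms(3) by (simp add: mmul_opid_right)
  then have aMa: "mmul n k a (mmul n k (Mprod M) a) u w = mmul n k a (Mprod M) u w"
    by (simp only: mmul_assoc)
  have "mmul n k (mmul n k p (Mprod M)) p u w
      = mmul n k (Mprod M) p u w - (mmul n k a (mmul n k (Mprod M) p) u w + mmul n k a (mmul n k (Mprod M) p) u w)"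
    unfolding mmul_assoc by (rule L[OF assms(2)])
  moreover have "mmul n k a (mmul n k (Mprod M) p) u w = - mmul n k a (Mprod M) u w"
    unfolding mmul_assoc[symmetric] R[OF assms(3)] unfolding mmul_assoc aMa by simp
  ultimately show ?thesis
    by (simp only: L[OF assms(2), of "Mprod M" w]) simp
qed

abbreviation "MM k \<equiv> block (idx n k) (Mprod M)"

text \<open>With Q = -P the relation (1 - P) M (1 + P) = 0 becomes the hypothesis of the right
  expansion; with Q = P it is that of the left expansion. This is why the two symmetrizers are
  treated differently.\<close>

lemma gen_manin_skew:
  assumes "Suc i < k"
  shows "(1 + gen (- 1) k i) * MM k * (1 - gen (- 1) k i) = 0"
proof -
  have "(1 + gen (- 1) k i) * MM k * (1 - gen (- 1) k i)
      = MM k - MM k * gen (- 1) k i + gen (- 1) k i * MM k - gen (- 1) k i * MM k * gen (- 1) k i"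
    by (simp add: algebra_simps)
  also have "\<dots> = 0"
  proof (rule rfmat_eqI)
    fix u w
    show "entry (MM k - MM k * gen (- 1) k i + gen (- 1) k i * MM k - gen (- 1) k i * MM k * gen (- 1) k i) u w
        = entry (0 :: (nat list, 'r) rfmat) u w"
      \<comment> \<open>Outside the block every factor is the identity, so the diagonal entries
        there are 1 - 1 + 1 - 1.\<close>
      using manin_block[OF assms, of u w]
      by (auto simp: gen_def block_times entry_block plus_rfmat.rep_eq minus_rfmat.rep_eq zero_rfmat.rep_eq
          c_uminus mmul_def cop_def sum_negf)
  qed
  finally show ?thesis .
qed

lemma gen_manin_sym:
  assumes "Suc i < k"
  shows "(1 - gen 1 k i) * MM k * (1 + gen 1 k i) = 0"
proof -
  have "(1 - gen 1 k i) * MM k * (1 + gen 1 k i)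
      = MM k + MM k * gen 1 k i - gen 1 k i * MM k - gen 1 k i * MM k * gen 1 k i"
    by (simp add: algebra_simps)
  also have "\<dots> = 0"
  proof (rule rfmat_eqI)
    fix u w
    show "entry (MM k + MM k * gen 1 k i - gen 1 k i * MM k - gen 1 k i * MM k * gen 1 k i) u w
        = entry (0 :: (nat list, 'r) rfmat) u w"
      using manin_block[OF assms, of u w]
      by (auto simp: gen_def block_times entry_block plus_rfmat.rep_eq minus_rfmat.rep_eq zero_rfmat.rep_eq
          mmul_def cop_def)
  qed
  finally show ?thesis .
qed

section \<open>Splitting traces along tensor factors\<close>

definition mtrace :: "nat \<Rightarrow> complex op \<Rightarrow> 'r" where
  "mtrace k X = trk n k (mmul n k (cop c X) (Mprod M))"

lemma mtrace_cong:
  "(\<And>u w. u \<in> idx n k \<Longrightarrow> w \<in> idx n k \<Longrightarrow> c (X u w) = c (Y u w)) \<Longrightarrow> mtrace k X = mtrace k Y"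
  by (simp add: mtrace_def trk_def mmul_def cop_def)

lemma mtrace_scale: "mtrace k (\<lambda>u w. z * X u w) = c z * mtrace k X"
  by (simp add: mtrace_def trk_def mmul_def cop_def c_mult sum_distrib_left mult.assoc)

text \<open>Entries of \<open>M\<close> on the first p positions stand to the left of the others,
  and the scalars of \<open>Y\<close> move past them by centrality; hence the order of the two
  traces, which matters in the final formulas.\<close>

lemma mtrace_tensor:
  assumes "\<And>a b x y. a \<in> idx n p \<Longrightarrow> b \<in> idx n p \<Longrightarrow> x \<in> idx n q \<Longrightarrow> y \<in> idx n q
    \<Longrightarrow> Z (a @ x) (b @ y) = X a b * Y x y"
  shows "mtrace (p + q) Z = mtrace p X * mtrace q Y"
proof -
  have "mmul n (p + q) (cop c Z) (Mprod M) (a @ x) (a @ x)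
      = mmul n p (cop c X) (Mprod M) a a * mmul n q (cop c Y) (Mprod M) x x"
    if "a \<in> idx n p" "x \<in> idx n q" for a x
    by (rule mmul_append, use assms that in \<open>simp_all add: cop_def c_mult Mprod_append length_idx\<close>)
      (rule c_central)
  then show ?thesis
    by (simp add: mtrace_def trk_def sum_idx_add sum_product)
qed

text \<open>Returns from the matrix ring to traces of complex operators. The words
  \<open>f \<sigma>\<close> are arbitrary, so normal forms, their reversals and their products with
  cycles are all covered.\<close>

lemma block_trace_word_sum:
  "block_trace (idx n k) (inv_fact m * (\<Sum>\<sigma>\<in>S. prod_list (map (gen s k) (f \<sigma>))) * MM k)
    = mtrace k (\<lambda>u w. 1 / fact m * (\<Sum>\<sigma>\<in>S. s ^ length (f \<sigma>) * Pword n k P (f \<sigma>) u w))"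
proof -
  have "entry (inv_fact m * (\<Sum>\<sigma>\<in>S. prod_list (map (gen s k) (f \<sigma>))) * MM k) u u
      = mmul n k (cop c (\<lambda>u w. 1 / fact m * (\<Sum>\<sigma>\<in>S. s ^ length (f \<sigma>) * Pword n k P (f \<sigma>) u w)))
          (Mprod M) u u" if "u \<in> idx n k" for u
  proof -
    have "entry (inv_fact m * (\<Sum>\<sigma>\<in>S. prod_list (map (gen s k) (f \<sigma>))) * MM k) u u
        = c (1 / fact m) * (\<Sum>\<sigma>\<in>S. entry (prod_list (map (gen s k) (f \<sigma>)) * MM k) u u)"
      by (simp add: inv_fact_def mult.assoc sum_distrib_right entry_sum)
    also have "\<dots> = c (1 / fact m) * (\<Sum>\<sigma>\<in>S. \<Sum>v\<in>idx n k.
        c (s ^ length (f \<sigma>) * Pword n k P (f \<sigma>) u v) * Mprod M v u)"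
      using that by (simp add: prod_gen entry_block_times entry_block)
    also have "\<dots> = c (1 / fact m) * (\<Sum>v\<in>idx n k. \<Sum>\<sigma>\<in>S.
        c (s ^ length (f \<sigma>) * Pword n k P (f \<sigma>) u v) * Mprod M v u)"
      by (subst sum.swap) simp
    finally show ?thesis
      unfolding mmul_def cop_def c_mult[of "1 / fact m"] c_sum
      by (simp add: sum_distrib_left sum_distrib_right mult.assoc)
  qed
  then show ?thesis by (simp add: block_trace_def mtrace_def trk_def)
qed

lemma block_trace_symm:
  assumes s: "s * s = 1"
  shows "block_trace (idx n k) (coxeter_gens.symm (gen s k) inv_fact k * MM k) = mtrace k (csym s k)"
proof -
  interpret coxeter_gens "gen s k" "k - 1" inv_fact by (rule coxeter_gens_gen[OF s])
  show ?thesis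
    using block_trace_word_sum[where f = "nf_word k"] by (simp add: symm_def symsum_def wprod_def csym_def[abs_def])
qed

text \<open>P_A along a full cycle on r+1 factors; by \<open>trace_Mbr\<close> its
  \<open>mtrace\<close> is the trace of the star power with exponent r+1.\<close>

definition cyc_op :: "nat \<Rightarrow> complex op" where
  "cyc_op r = Pword n (Suc r) P (rev [0..<r])"

text \<open>The symmetrizer uses the positions below m and the word the positions from m on, so the
  trace splits. The r letters of the word contribute the factor s^r.\<close>

lemma block_trace_right_term:
  fixes m r
  defines "k \<equiv> m + Suc r"
  assumes s: "s * s = 1"
  shows "block_trace (idx n k) (prod_list (map (gen s k) (rev [m..<k - 1])) * coxeter_gens.symm (gen s k) inv_fact m * MM k)
    = mtrace m (csym s m) * (c (s ^ r) * mtrace (Suc r) (cyc_op r))"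
proof -
  interpret coxeter_gens "gen s k" "k - 1" inv_fact by (rule coxeter_gens_gen[OF s])
  have shift: "rev [m..<k - 1] = map ((+) m) (rev [0..<r])"
    by (rule nth_equalityI) (auto simp: k_def rev_nth)
  let ?f = "\<lambda>\<sigma>. map ((+) m) (rev [0..<r]) @ nf_word m \<sigma>"
  have "prod_list (map (gen s k) (rev [m..<k - 1])) * symm m
      = inv_fact m * (\<Sum>\<sigma> | \<sigma> permutes {..<m}. prod_list (map (gen s k) (?f \<sigma>)))"
  proof -
    have "x * symm m = inv_fact m * (x * symsum m)" for x
      unfolding symm_def by (metis central mult.assoc)
    then show ?thesis
      by (simp only: shift symsum_def wprod_def sum_distrib_left map_append prod_list.append)
  qed
  then have "block_trace (idx n k) (prod_list (map (gen s k) (rev [m..<k - 1])) * symm m * MM k)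
      = mtrace k (\<lambda>u w. 1 / fact m * (\<Sum>\<sigma> | \<sigma> permutes {..<m}. s ^ length (?f \<sigma>) * Pword n k P (?f \<sigma>) u w))"
    by (simp only: block_trace_word_sum)
  also have "\<dots> = mtrace m (csym s m) * mtrace (Suc r) (\<lambda>u w. s ^ r * cyc_op r u w)"
    unfolding k_def
  proof (rule mtrace_tensor)
    fix a b x y assume *: "a \<in> idx n m" "b \<in> idx n m" "x \<in> idx n (Suc r)" "y \<in> idx n (Suc r)"
    have "Pword n (m + Suc r) P (?f \<sigma>) (a @ x) (b @ y) = Pword n m P (nf_word m \<sigma>) a b * cyc_op r x y"
      if "\<sigma> permutes {..<m}" for \<sigma>
      unfolding cyc_op_def using * that by (intro Pword_tensor') (auto simp: set_nf_word)
    then show "1 / fact m * (\<Sum>\<sigma> | \<sigma> permutes {..<m}. s ^ length (?f \<sigma>) * Pword n (m + Suc r) P (?f \<sigma>) (a @ x) (b @ y))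
        = csym s m a b * (s ^ r * cyc_op r x y)"
      unfolding csym_def mult.assoc sum_distrib_right
      by (intro arg_cong[where f = "(*) (1 / fact m)"] sum.cong refl) (simp add: power_add mult_ac)
  qed
  finally show ?thesis by (simp only: mtrace_scale)
qed

text \<open>Replacing each letter i by m-2-i flips the diagram of the m-1 generators on m factors,
  which does not change the symmetrizer by \<open>symm_rev\<close>.\<close>

lemma c_csym_rev:
  assumes s: "s * s = 1" and "u \<in> idx n m" "w \<in> idx n m"
  shows "c (1 / fact m * (\<Sum>\<sigma> | \<sigma> permutes {..<m}. s ^ length (nf_word m \<sigma>) *
      Pword n m P (map (\<lambda>i. m - 2 - i) (nf_word m \<sigma>)) u w)) = c (csym s m u w)"
proof (cases m)
  case 0
  then show ?thesis by (simp add: csym_def)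
next
  case (Suc m')
  interpret coxeter_gens "gen s m" "m - 1" inv_fact by (rule coxeter_gens_gen[OF s])
  interpret R: coxeter_gens "\<lambda>i. gen s m (m - 1 - 1 - i)" "m - 1" inv_fact by (rule coxeter_gens_rev)
  have w: "R.wprod ws = prod_list (map (gen s m) (map (\<lambda>i. m - 2 - i) ws))" for ws
    unfolding R.wprod_def by (simp add: o_def numeral_2_eq_2)
  have "entry (R.symm m) u w = entry (symm m) u w"
    using symm_rev Suc by simp
  moreover have "entry (R.symm m) u w = c (1 / fact m) * (\<Sum>\<sigma> | \<sigma> permutes {..<m}.
      c (s ^ length (nf_word m \<sigma>) * Pword n m P (map (\<lambda>i. m - 2 - i) (nf_word m \<sigma>)) u w))"
    unfolding R.symm_def R.symsum_def w prod_gen using assms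
    by (simp only: inv_fact_def entry_diag_times entry_sum entry_block finite_idx length_map if_True)
  ultimately show ?thesis
    using entry_symm[OF assms] by (simp only: c_mult[of "1 / fact m"] c_sum)
qed

text \<open>The flip moves the symmetrizer to the last m positions and turns the ascending word into
  r-1, ..., 0 on the first r+1. This yields the cycle of \<open>cyc_op\<close> and places its trace
  on the left.\<close>

lemma block_trace_left_term:
  fixes m r
  defines "k \<equiv> Suc r + m"
  shows "block_trace (idx n k) (coxeter_gens.symm (\<lambda>i. gen 1 k (k - 1 - 1 - i)) inv_fact m *
      prod_list (map (\<lambda>i. gen 1 k (k - 1 - 1 - i)) [m..<k - 1]) * MM k)
    = mtrace (Suc r) (cyc_op r) * mtrace m (csym 1 m)"
proof -
  interpret G: coxeter_gens "gen 1 k" "k - 1" inv_fact by (rule coxeter_gens_gen) simp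
  interpret coxeter_gens "\<lambda>i. gen 1 k (k - 1 - 1 - i)" "k - 1" inv_fact by (rule G.coxeter_gens_rev)
  let ?h = "\<lambda>i. k - 1 - 1 - i" and ?g = "\<lambda>\<sigma>. map (\<lambda>i. m - 2 - i) (nf_word m \<sigma>)"
  let ?f = "\<lambda>\<sigma>. map ((+) (Suc r)) (?g \<sigma>) @ rev [0..<r]"
  have cyc: "map ?h [m..<k - 1] = rev [0..<r]"
    by (rule nth_equalityI) (auto simp: k_def rev_nth)
  \<comment> \<open>For letters i with i+1 < m one has k-2-i = (r+1) + (m-2-i), so the flip on k
    factors is the flip on m factors followed by a shift.\<close>
  have f: "map ?h (nf_word m \<sigma> @ [m..<k - 1]) = ?f \<sigma>" if "\<sigma> permutes {..<m}" for \<sigma>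
  proof -
    have "map ?h (nf_word m \<sigma>) = map ((+) (Suc r)) (?g \<sigma>)"
      unfolding map_map by (rule map_cong[OF refl]) (use set_nf_word[OF that] in \<open>fastforce simp: k_def\<close>)
    then show ?thesis by (simp only: map_append cyc)
  qed
  have "symm m * wprod [m..<k - 1] = inv_fact m *
      (\<Sum>\<sigma> | \<sigma> permutes {..<m}. prod_list (map (gen 1 k) (map ?h (nf_word m \<sigma> @ [m..<k - 1]))))"
    unfolding symm_def symsum_def wprod_def by (simp add: sum_distrib_right mult.assoc o_def)
  also have "\<dots> = inv_fact m * (\<Sum>\<sigma> | \<sigma> permutes {..<m}. prod_list (map (gen 1 k) (?f \<sigma>)))"
    using f by (intro arg_cong[where f = "(*) (inv_fact m)"] sum.cong refl) (simp only: mem_Collect_eq)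
  finally have "block_trace (idx n k) (symm m * wprod [m..<k - 1] * MM k)
      = mtrace k (\<lambda>u w. 1 / fact m * (\<Sum>\<sigma> | \<sigma> permutes {..<m}. 1 ^ length (?f \<sigma>) * Pword n k P (?f \<sigma>) u w))"
    by (simp only: block_trace_word_sum)
  also have "\<dots> = mtrace (Suc r) (cyc_op r) * mtrace m (\<lambda>u w. 1 / fact m *
      (\<Sum>\<sigma> | \<sigma> permutes {..<m}. 1 ^ length (nf_word m \<sigma>) * Pword n m P (?g \<sigma>) u w))"
    unfolding k_def
  proof (rule mtrace_tensor)
    fix a b x y assume *: "a \<in> idx n (Suc r)" "b \<in> idx n (Suc r)" "x \<in> idx n m" "y \<in> idx n m"
    have "Pword n (Suc r + m) P (?f \<sigma>) (a @ x) (b @ y) = cyc_op r a b * Pword n m P (?g \<sigma>) x y"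
      if "\<sigma> permutes {..<m}" for \<sigma>
      unfolding cyc_op_def using * set_nf_word[OF that] by (intro Pword_tensor') fastforce+
    then show "1 / fact m * (\<Sum>\<sigma> | \<sigma> permutes {..<m}. 1 ^ length (?f \<sigma>) * Pword n (Suc r + m) P (?f \<sigma>) (a @ x) (b @ y))
        = cyc_op r a b * (1 / fact m * (\<Sum>\<sigma> | \<sigma> permutes {..<m}. 1 ^ length (nf_word m \<sigma>) * Pword n m P (?g \<sigma>) x y))"
      by (simp add: sum_distrib_left)
  qed
  also have "mtrace m (\<lambda>u w. 1 / fact m *
      (\<Sum>\<sigma> | \<sigma> permutes {..<m}. 1 ^ length (nf_word m \<sigma>) * Pword n m P (?g \<sigma>) u w)) = mtrace m (csym 1 m)"
    by (rule mtrace_cong, rule c_csym_rev) auto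
  finally show ?thesis by (simp only: wprod_def)
qed

section \<open>Newton identities for the coefficients\<close>

lemma newton_skew:
  "of_nat (Suc N) * mtrace (Suc N) (csym (- 1) (Suc N))
    = (\<Sum>m\<le>N. mtrace m (csym (- 1) m) * (c ((- 1) ^ (N - m)) * mtrace (Suc (N - m)) (cyc_op (N - m))))"
proof -
  let ?k = "Suc N"
  interpret coxeter_trace "gen (- 1) ?k" "?k - 1" inv_fact "block_trace (idx n ?k)"
    by (rule coxeter_trace_gen) simp
  have "of_nat ?k * block_trace (idx n ?k) (symm ?k * MM ?k)
      = (\<Sum>m<Suc (?k - 1). block_trace (idx n ?k) (wprod (rev [m..<?k - 1]) * symm m * MM ?k))"
    using trace_symm_expand_right[of "MM ?k"] gen_manin_skew[of _ ?k] by simp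
  also have "\<dots> = (\<Sum>m\<le>N. mtrace m (csym (- 1) m) * (c ((- 1) ^ (N - m)) * mtrace (Suc (N - m)) (cyc_op (N - m))))"
  proof (rule sum.cong)
    fix m assume "m \<in> {..N}"
    then have "?k = m + Suc (N - m)" by simp
    then show "block_trace (idx n ?k) (wprod (rev [m..<?k - 1]) * symm m * MM ?k)
        = mtrace m (csym (- 1) m) * (c ((- 1) ^ (N - m)) * mtrace (Suc (N - m)) (cyc_op (N - m)))"
      using block_trace_right_term[of "- 1" m "N - m"] by (simp add: wprod_def)
  qed auto
  finally show ?thesis by (simp add: block_trace_symm del: of_nat_Suc)
qed

text \<open>The left expansion is applied to the flipped generators so that the coefficients of T
  precede those of S; on all k factors the flipped symmetrizer is the original one.\<close>

lemma newton_sym: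
  "of_nat (Suc N) * mtrace (Suc N) (csym 1 (Suc N))
    = (\<Sum>m\<le>N. mtrace (Suc (N - m)) (cyc_op (N - m)) * mtrace m (csym 1 m))"
proof -
  let ?k = "Suc N"
  interpret G: coxeter_trace "gen 1 ?k" "?k - 1" inv_fact "block_trace (idx n ?k)"
    by (rule coxeter_trace_gen) simp
  interpret coxeter_trace "\<lambda>i. gen 1 ?k (?k - 1 - 1 - i)" "?k - 1" inv_fact "block_trace (idx n ?k)"
    by (intro coxeter_trace.intro coxeter_trace_axioms.intro G.coxeter_gens_rev G.trace_add G.trace_gen) simp
  have "of_nat (Suc (?k - 1)) * block_trace (idx n ?k) (symm (Suc (?k - 1)) * MM ?k)
      = (\<Sum>m<Suc (?k - 1). block_trace (idx n ?k) (symm m * wprod [m..<?k - 1] * MM ?k))"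
    by (intro trace_symm_expand_left gen_manin_sym) simp
  also have "\<dots> = (\<Sum>m\<le>N. mtrace (Suc (N - m)) (cyc_op (N - m)) * mtrace m (csym 1 m))"
  proof (rule sum.cong)
    fix m assume "m \<in> {..N}"
    then have "?k = Suc (N - m) + m" by simp
    then show "block_trace (idx n ?k) (symm m * wprod [m..<?k - 1] * MM ?k)
        = mtrace (Suc (N - m)) (cyc_op (N - m)) * mtrace m (csym 1 m)"
      unfolding wprod_def using block_trace_left_term[of "N - m" m] by (simp only:)
  qed auto
  finally show ?thesis unfolding G.symm_rev by (simp add: block_trace_symm del: of_nat_Suc)
qed

section \<open>Passage to formal power series\<close>

lemma Sser_nth: "Sser c n A M $ k = mtrace k (csym 1 k)"
  unfolding Sser_def using mtrace_cong[of k "Ssym n k P" "csym 1 k"] c_Ssym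
  by (simp add: mtrace_def)

lemma Aser_nth: "Aser c n A M $ k = (- 1) ^ k * mtrace k (csym (- 1) k)"
  unfolding Aser_def using mtrace_cong[of k "Asym n k P" "csym (- 1) k"] c_Asym
  by (simp add: mtrace_def)

lemma Tser_nth: "Tser c n A M $ k = mtrace (Suc k) (cyc_op k)"
  by (simp add: Tser_def trace_Mbr mtrace_def cyc_op_def)

lemma c_neg_one_power: "c ((- 1) ^ k) = (- 1) ^ k"
  by (induction k) (simp_all add: c_one c_uminus)

theorem fps_deriv_Aser: "fps_deriv (Aser c n A M) = - (Aser c n A M * Tser c n A M)"
proof (rule fps_ext)
  fix N
  \<comment> \<open>Signs are values of \<open>c\<close> and therefore central.\<close>
  have sgn: "x * (- 1) ^ j = (- 1) ^ j * (x :: 'r)" for x j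
    using c_central[of "(- 1) ^ j" x] by (simp add: c_neg_one_power)
  have summand: "(- 1) ^ Suc N * (mtrace m (csym (- 1) m) * (c ((- 1) ^ (N - m)) * mtrace (Suc (N - m)) (cyc_op (N - m))))
      = - ((- 1) ^ m * mtrace m (csym (- 1) m) * mtrace (Suc (N - m)) (cyc_op (N - m)))" if "m \<le> N" for m
  proof -
    \<comment> \<open>The sign of the series and that of the cycle combine: N+1 and N-m together
      have the parity of m+1.\<close>
    have "Suc N + (N - m) = Suc m + 2 * (N - m)" using that by simp
    then have "(- 1 :: 'r) ^ Suc N * (- 1) ^ (N - m) = - ((- 1) ^ m)"
      by (simp only: power_add[symmetric]) (simp add: power_add power_mult)
    moreover have "x * ((- 1) ^ (N - m) * y) = (- 1) ^ (N - m) * (x * y)" for x y :: 'r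
      by (metis sgn mult.assoc)
    then have "(- 1) ^ Suc N * (x * ((- 1) ^ (N - m) * y)) = (- 1) ^ Suc N * (- 1) ^ (N - m) * (x * y)"
      for x y :: 'r by (simp only: mult.assoc)
    ultimately show ?thesis
      unfolding c_neg_one_power by (simp only: mult.assoc mult_minus_left)
  qed
  have "of_nat (Suc N) * ((- 1) ^ Suc N * z) = (- 1) ^ Suc N * (of_nat (Suc N) * z)" for z :: 'r
    by (metis sgn mult.assoc)
  then have "fps_deriv (Aser c n A M) $ N = (- 1) ^ Suc N * (of_nat (Suc N) * mtrace (Suc N) (csym (- 1) (Suc N)))"
    by (simp add: Aser_nth del: power_Suc of_nat_Suc)
  also have "\<dots> = - (\<Sum>m\<le>N. (- 1) ^ m * mtrace m (csym (- 1) m) * mtrace (Suc (N - m)) (cyc_op (N - m)))"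
    unfolding newton_skew sum_distrib_left sum_negf[symmetric]
    by (intro sum.cong refl summand) simp
  finally show "fps_deriv (Aser c n A M) $ N = (- (Aser c n A M * Tser c n A M)) $ N"
    by (simp add: fps_mult_nth Aser_nth Tser_nth atLeast0AtMost)
qed

theorem fps_deriv_Sser: "fps_deriv (Sser c n A M) = Tser c n A M * Sser c n A M"
proof (rule fps_ext)
  fix N
  have "fps_deriv (Sser c n A M) $ N = (\<Sum>m\<le>N. mtrace (Suc (N - m)) (cyc_op (N - m)) * mtrace m (csym 1 m))"
    using newton_sym[of N] by (simp add: Sser_nth)
  also have "\<dots> = (\<Sum>m\<le>N. mtrace (Suc m) (cyc_op m) * mtrace (N - m) (csym 1 (N - m)))"
    by (rule sum.reindex_bij_witness[of _ "\<lambda>m. N - m" "\<lambda>m. N - m"]) auto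
  finally show "fps_deriv (Sser c n A M) $ N = (Tser c n A M * Sser c n A M) $ N"
    by (simp add: fps_mult_nth Sser_nth Tser_nth atLeast0AtMost)
qed

end

theorem mainTheorem16:
  fixes c :: "complex \<Rightarrow> 'r::ring_1"
    and n :: nat
    and A :: "nat \<Rightarrow> nat \<Rightarrow> nat \<Rightarrow> nat \<Rightarrow> complex"
    and M :: "nat \<Rightarrow> nat \<Rightarrow> 'r"
  assumes c_one: "c 1 = 1"
    and c_add: "\<And>x y. c (x + y) = c x + c y"
    and c_mult: "\<And>x y. c (x * y) = c x * c y"
    and c_central: "\<And>x r. c x * r = r * c x"
    and A_idem: "\<forall>u\<in>idx n 2. \<forall>w\<in>idx n 2. mmul n 2 (op2 A) (op2 A) u w = op2 A u w"
    and braid: "\<forall>u\<in>idx n 3. \<forall>w\<in>idx n 3.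
       mmul n 3 (mmul n 3 (Padj (PA A) 0) (Padj (PA A) 1)) (Padj (PA A) 0) u w =
       mmul n 3 (mmul n 3 (Padj (PA A) 1) (Padj (PA A) 0)) (Padj (PA A) 1) u w"
    and Manin: "is_Manin c n A M"
  shows "fps_deriv (Aser c n A M) = - (Aser c n A M * Tser c n A M) \<and>
         fps_deriv (Sser c n A M) = Tser c n A M * Sser c n A M"
proof -
  interpret manin_matrix c n A M
    by (rule manin_matrix.intro) (fact assms)+
  show ?thesis using fps_deriv_Aser fps_deriv_Sser by blast
qed

end
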